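(* Let $G$ be an $8$-regular optimal $1$-toroidal graph (O1TG). Then $\kappa(G)\in\{6,8\}$, where $\kappa(G)$ denotes the connectivity of $G$. Furthermore, $G$ is $8$-connected if and only if its quadrangular subgraph $Q(G)$ is not isomorphic to $Q(p,r,3)$ for any integers $p\geq 4$ and $r\geq 0$.
   Context: All graphs are finite, simple and connected. A $1$-embedded graph on a closed surface $F^2$ is a graph drawn on $F^2$ (good drawing: vertices at distinct points, adjacent edges do not cross, no three edges cross at one point, no tangential touching) so that every edge is involved in at most one crossing with another edge. Every $1$-embedded graph $G$ on $F^2$ with at least three vertices satisfies $|E(G)|\leq 4|V(G)|-4\chi(F^2)$, where $\chi(F^2)$ is the Euler characteristic; if equality holds, $G$ is optimal. An optimal $1$-toroidal graph (O1TG) is an optimal $1$-embedded graph on the torus $T^2$, so $|E(G)|=4|V(G)|$. An edge is crossing if it crosses another edge and non-crossing otherwise. The quadrangular subgraph $Q(G)$ is the embedded graph consisting of all vertices and all non-crossing edges of $G$; it is known that $Q(G)$ is a quadrangulation (every face is a $2$-cell bounded by a $4$-cycle) and $G$ is obtained from $Q(G)$ by adding a pair of crossing diagonal edges in each face. If $G$ is an $8$-regular O1TG then $Q(G)$ is $4$-regular. For integers $p\geq 1$, $q\geq 3$, $r\geq 0$, $Q(p,r,q)$ denotes the $4$-regular quadrangulation of the torus obtained from a $p\times q$ rectangular grid by identifying opposite sides so that one gets first an annulus with two boundary cycles of length $q$, and then the torus by gluing these two cycles with a shift of $r$; i.e. it is the quotient of the standard square grid on $\mathbb{Z}^2\subset\mathbb{R}^2$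 (faces the unit squares) by the translation lattice generated by $(0,q)$ and $(p,r)$. It has $pq$ vertices, and $q$ is the length of its meridian cycles. Isomorphism of quadrangulations is understood as isomorphism of embedded graphs. *)

theory Defs
  imports Main "HOL-Combinatorics.Orbits"
begin

section \<open>Finite simple graphs and connectivity\<close>

definition simple_graph :: "'a set \<Rightarrow> 'a set set \<Rightarrow> bool" where
  "simple_graph V E \<longleftrightarrow> finite V \<and> (\<forall>e\<in>E. e \<subseteq> V \<and> card e = 2)"

text \<open>Connectedness of the subgraph induced by \<open>W\<close>; the empty graph is not connected.\<close>

definition connected_on :: "'a set set \<Rightarrow> 'a set \<Rightarrow> bool" where
  "connected_on E W \<longleftrightarrow> W \<noteq> {} \<and>
     (\<forall>u\<in>W. \<forall>v\<in>W. (u, v) \<in> {(x, y). x \<in> W \<and> y \<in> W \<and> {x, y} \<in> E}\<^sup>*)"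

definition degree :: "'a set set \<Rightarrow> 'a \<Rightarrow> nat" where
  "degree E v = card {e \<in> E. v \<in> e}"

definition regular :: "'a set \<Rightarrow> 'a set set \<Rightarrow> nat \<Rightarrow> bool" where
  "regular V E k \<longleftrightarrow> (\<forall>v\<in>V. degree E v = k)"

definition k_connected :: "'a set \<Rightarrow> 'a set set \<Rightarrow> nat \<Rightarrow> bool" where
  "k_connected V E k \<longleftrightarrow>
     k < card V \<and> (\<forall>S. S \<subseteq> V \<and> card S < k \<longrightarrow> connected_on E (V - S))"

text \<open>For a complete graph on \<open>n\<close> vertices this is \<open>n - 1\<close>.\<close>

definition vertex_connectivity :: "'a set \<Rightarrow> 'a set set \<Rightarrow> nat" where
  "vertex_connectivity V E = Max {k. k_connected V E k}"


section \<open>Combinatorial maps\<close>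

text \<open>
  An embedding of a graph in an oriented closed surface is represented by its rotation system.
  A dart is an edge with a direction; \<open>opp\<close> reverses a dart, and \<open>nxt\<close> sends a dart to the next
  dart with the same tail in the cyclic order around that tail. The vertices, edges and faces
  are the orbits of \<open>nxt\<close>, of \<open>opp\<close> and of \<open>nxt \<circ> opp\<close>. Isolated vertices are invisible in this
  representation. Only the values of \<open>opp\<close> and \<open>nxt\<close> on \<open>darts\<close> are meaningful.
\<close>

record 'd cmap =
  darts :: "'d set"
  opp :: "'d \<Rightarrow> 'd"
  nxt :: "'d \<Rightarrow> 'd"

definition euler_char :: "'d cmap \<Rightarrow> int" where
  "euler_char M =
     int (card (orbit (nxt M) ` darts M))
     - int (card (orbit (opp M) ` darts M))
     + int (card (orbit (nxt M \<circ> opp M) ` darts M))"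

text \<open>
  Isomorphism of embedded graphs. The homeomorphism of surfaces may preserve the orientation
  (first disjunct) or reverse it (second disjunct: \<open>h\<close> conjugates \<open>nxt M\<close> to the inverse of
  \<open>nxt N\<close>).
\<close>

definition map_iso :: "'d cmap \<Rightarrow> 'e cmap \<Rightarrow> bool" where
  "map_iso M N \<longleftrightarrow> (\<exists>h. bij_betw h (darts M) (darts N)
     \<and> (\<forall>d\<in>darts M. h (opp M d) = opp N (h d))
     \<and> ((\<forall>d\<in>darts M. h (nxt M d) = nxt N (h d))
        \<or> (\<forall>d\<in>darts M. nxt N (h (nxt M d)) = h d)))"

text \<open>
  Deletion of edges from an embedded graph: the cyclic order around a vertex is the one induced
  on the remaining darts, i.e. the first return of \<open>nxt\<close> to \<open>D\<close>.
\<close>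

definition submap :: "'d cmap \<Rightarrow> 'd set \<Rightarrow> 'd cmap" where
  "submap M D = \<lparr> darts = darts M \<inter> D, opp = opp M,
     nxt = (\<lambda>d. (nxt M ^^ (LEAST n. 0 < n \<and> (nxt M ^^ n) d \<in> D)) d) \<rparr>"


section \<open>1-embedded graphs\<close>

text \<open>
  A drawing of the graph \<open>(V, E)\<close> in which every edge is involved in at most one crossing is
  given by a set \<open>X\<close> of pairs \<open>{e, f}\<close> of edges that cross, and by the rotation system \<open>\<rho>\<close> of its
  planarization, the embedded graph obtained by turning each crossing point into a vertex.
  The planarization is simple, because crossing edges have no common end, so a dart is an
  ordered pair of adjacent points and \<open>\<rho> x\<close> permutes the neighbours of the point \<open>x\<close>.
\<close>

datatype 'a point = Vert 'a | Cross "'a set set"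

definition crossing_pairs :: "'a set set \<Rightarrow> 'a set set set \<Rightarrow> bool" where
  "crossing_pairs E X \<longleftrightarrow>
     (\<forall>c\<in>X. \<exists>e\<in>E. \<exists>f\<in>E. c = {e, f} \<and> e \<inter> f = {}) \<and> pairwise disjnt X"

definition noncrossing_edges :: "'a set set \<Rightarrow> 'a set set set \<Rightarrow> 'a set set" where
  "noncrossing_edges E X = E - \<Union>X"

definition points :: "'a set \<Rightarrow> 'a set set set \<Rightarrow> 'a point set" where
  "points V X = Vert ` V \<union> Cross ` X"

fun adjacent_points :: "'a set set \<Rightarrow> 'a set set set \<Rightarrow> 'a point \<Rightarrow> 'a point \<Rightarrow> bool" where
  "adjacent_points E X (Vert u) (Vert v) \<longleftrightarrow> {u, v} \<in> noncrossing_edges E X"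
| "adjacent_points E X (Vert u) (Cross c) \<longleftrightarrow> c \<in> X \<and> u \<in> \<Union>c"
| "adjacent_points E X (Cross c) (Vert u) \<longleftrightarrow> c \<in> X \<and> u \<in> \<Union>c"
| "adjacent_points E X (Cross c) (Cross c') \<longleftrightarrow> False"

definition planarization ::
    "'a set set \<Rightarrow> 'a set set set \<Rightarrow> ('a point \<Rightarrow> 'a point \<Rightarrow> 'a point) \<Rightarrow> ('a point \<times> 'a point) cmap"
  where
  "planarization E X \<rho> = \<lparr> darts = {(x, y). adjacent_points E X x y},
     opp = (\<lambda>(x, y). (y, x)), nxt = (\<lambda>(x, y). (x, \<rho> x y)) \<rparr>"

text \<open>
  The last condition says that the two edges of a crossing pass through each other instead of
  touching: the four half-edges at a crossing point belong alternately to the two edges.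
\<close>

definition one_embedding ::
    "'a set \<Rightarrow> 'a set set \<Rightarrow> 'a set set set \<Rightarrow> ('a point \<Rightarrow> 'a point \<Rightarrow> 'a point) \<Rightarrow> bool" where
  "one_embedding V E X \<rho> \<longleftrightarrow>
     simple_graph V E \<and> connected_on E V \<and> crossing_pairs E X
     \<and> (\<forall>x\<in>points V X. {y. adjacent_points E X x y} \<noteq> {} \<longrightarrow>
          cyclic_on (\<rho> x) {y. adjacent_points E X x y})
     \<and> (\<forall>c\<in>X. \<forall>e\<in>c. \<forall>u\<in>e. \<rho> (Cross c) (Vert u) \<notin> Vert ` e)"

text \<open>
  The Euler characteristic of a connected rotation system is \<open>2 - 2 * g\<close>, where \<open>g\<close> is its genus,
  and it describes a drawing on the torus iff \<open>g \<le> 1\<close>. Genus 0 is included because faces of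
  a drawing need not be 2-cells.
\<close>

definition one_toroidal ::
    "'a set \<Rightarrow> 'a set set \<Rightarrow> 'a set set set \<Rightarrow> ('a point \<Rightarrow> 'a point \<Rightarrow> 'a point) \<Rightarrow> bool" where
  "one_toroidal V E X \<rho> \<longleftrightarrow> one_embedding V E X \<rho> \<and> euler_char (planarization E X \<rho>) \<ge> 0"

definition optimal_one_toroidal ::
    "'a set \<Rightarrow> 'a set set \<Rightarrow> 'a set set set \<Rightarrow> ('a point \<Rightarrow> 'a point \<Rightarrow> 'a point) \<Rightarrow> bool" where
  "optimal_one_toroidal V E X \<rho> \<longleftrightarrow> one_toroidal V E X \<rho> \<and> card E = 4 * card V"

definition quadrangular_subgraph ::
    "'a set set \<Rightarrow> 'a set set set \<Rightarrow> ('a point \<Rightarrow> 'a point \<Rightarrow> 'a point) \<Rightarrow> ('a point \<times> 'a point) cmap"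
  where
  "quadrangular_subgraph E X \<rho> = submap (planarization E X \<rho>) (range Vert \<times> range Vert)"


section \<open>The quadrangulations \<open>Q(p,r,q)\<close>\<close>

text \<open>
  A dart of the square grid is a grid point together with a unit vector. The torus map is the
  quotient by the translations generated by \<open>(0, q)\<close> and \<open>(p, r)\<close>; its darts are the classes of
  darts of the grid, on which \<open>opp\<close> and \<open>nxt\<close> act by taking images.
\<close>

type_synonym grid_dart = "(int \<times> int) \<times> (int \<times> int)"

definition grid_map :: "grid_dart cmap" where
  "grid_map = \<lparr> darts = UNIV \<times> {(1, 0), (0, 1), (-1, 0), (0, -1)},
     opp = (\<lambda>((a, b), (s, t)). ((a + s, b + t), (- s, - t))),
     nxt = (\<lambda>((a, b), (s, t)). ((a, b), (- t, s))) \<rparr>"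

definition lattice_rel :: "int \<Rightarrow> int \<Rightarrow> int \<Rightarrow> grid_dart rel" where
  "lattice_rel p r q = {(((a, b), w), ((a', b'), w')) | a b w a' b' w'.
     w \<in> {(1, 0), (0, 1), (-1, 0), (0, -1)} \<and> w' = w
     \<and> (\<exists>i j. a' = a + i * p \<and> b' = b + i * r + j * q)}"

definition torus_quad :: "int \<Rightarrow> int \<Rightarrow> int \<Rightarrow> grid_dart set cmap" where
  "torus_quad p r q = \<lparr> darts = darts grid_map // lattice_rel p r q,
     opp = (\<lambda>C. opp grid_map ` C), nxt = (\<lambda>C. nxt grid_map ` C) \<rparr>"

end

theory Submission
  imports Defs "HOL-Library.Product_Plus"
begin

text \<open>
  A face of the planarization with \<open>k\<close> corners, \<open>x\<close> of them at crossings, has \<open>k \<ge> 3\<close> and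
  \<open>2 * x \<le> k\<close>, so \<open>3 * k - x - 8 \<ge> 0\<close> with equality only for \<open>(k, x) = (3, 1)\<close>. Euler's formula
  makes the sum of these numbers nonpositive, so every face is a triangle with exactly one
  crossing; hence the non-crossing edges form a 4-regular quadrangulation. Developing the square
  grid onto it presents the graph as the quotient of the king's graph on \<open>\<int>\<^sup>2\<close> by a lattice of
  translations; rotations cannot occur, because the eight neighbours of a vertex are distinct.

  In this Cayley graph of an abelian group, an atom (a smallest set whose boundary has minimum
  size) that contains \<open>0\<close> is a subgroup \<open>H\<close>, because distinct atoms are disjoint. If the boundary
  has fewer than 8 elements, counting cosets of \<open>H\<close> in its closed neighbourhood shows that \<open>H\<close> is
  generated by a unit vector of order 3 and that the boundary consists of two further cosets.
  Such short cycles are exactly what distinguishes the maps \<open>Q(p,r,3)\<close>.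
\<close>

section \<open>Atoms of a graph\<close>

text \<open>The weight \<open>3 * k - x - 8\<close> is the combination from which both unknowns
  cancel: the corners of all faces number \<open>8 * card V + 4 * card X\<close>, those at crossings
  \<open>4 * card X\<close>, and Euler's inequality yields at least
  \<open>3 * card V + card X\<close> faces. The grid is developed on darts, not on vertices, because
  it might return to a vertex turned. A quarter or half turn of the grid has its centre at a vertex,
  an edge midpoint or a face centre, and near that centre two points at short distance would be
  identified. The subgroup \<open>H\<close> is studied through its preimage in the integer grid. No
  classification of subgroups is needed: a few short vectors in the preimage already bring every
  grid point within one king's step of it, and then \<open>H\<close> would dominate
  \<open>V\<close>. The bound \<open>p >= 4\<close> corresponds to \<open>10 <= card V\<close>. An
  8-regular graph on nine vertices is complete, hence 8-connected, although straight 3-cycles may be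
  present there as well.\<close>

definition closed_nbhd :: "'a set set \<Rightarrow> 'a set \<Rightarrow> 'a set" where
  "closed_nbhd E C = C \<union> {v. \<exists>c\<in>C. {c, v} \<in> E}"

definition boundary :: "'a set set \<Rightarrow> 'a set \<Rightarrow> 'a set" where
  "boundary E C = closed_nbhd E C - C"

definition fragment :: "'a set \<Rightarrow> 'a set set \<Rightarrow> 'a set \<Rightarrow> bool" where
  "fragment V E C \<longleftrightarrow> C \<subseteq> V \<and> C \<noteq> {} \<and> closed_nbhd E C \<noteq> V"

definition atom :: "'a set \<Rightarrow> 'a set set \<Rightarrow> 'a set \<Rightarrow> bool" where
  "atom V E C \<longleftrightarrow> fragment V E C \<and>
     (\<forall>D. fragment V E D \<longrightarrow> card (boundary E C) < card (boundary E D) \<or>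
        card (boundary E C) = card (boundary E D) \<and> card C \<le> card D)"

lemma exists_atom:
  assumes "fragment V E D"
  shows "\<exists>C. atom V E C"
proof -
  obtain B where B: "fragment V E B" "\<And>C. fragment V E C \<Longrightarrow> card (boundary E B) \<le> card (boundary E C)"
    using ex_has_least_nat[of "fragment V E" D "\<lambda>C. card (boundary E C)"] assms by blast
  let ?P = "\<lambda>C. fragment V E C \<and> card (boundary E C) = card (boundary E B)"
  obtain C where "?P C" "\<And>D. ?P D \<Longrightarrow> card C \<le> card D"
    using ex_has_least_nat[of ?P B card] B(1) by blast
  then have "atom V E C"
    using B(2) unfolding atom_def by (metis le_neq_implies_less)
  then show ?thesis ..
qed

lemma closed_nbhd_subset: "simple_graph V E \<Longrightarrow> C \<subseteq> V \<Longrightarrow> closed_nbhd E C \<subseteq> V"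
  unfolding simple_graph_def closed_nbhd_def by blast

lemma card_closed_nbhd:
  assumes "simple_graph V E" "C \<subseteq> V"
  shows "card (closed_nbhd E C) = card C + card (boundary E C)"
proof -
  have "finite (closed_nbhd E C)"
    using closed_nbhd_subset[OF assms] assms(1) finite_subset unfolding simple_graph_def by blast
  moreover have "C \<subseteq> closed_nbhd E C" by (auto simp: closed_nbhd_def)
  ultimately show ?thesis
    unfolding boundary_def by (metis card_Diff_subset card_mono finite_subset le_add_diff_inverse)
qed

lemma closed_nbhd_Un: "closed_nbhd E (C \<union> D) = closed_nbhd E C \<union> closed_nbhd E D"
  by (auto simp: closed_nbhd_def)

lemma closed_nbhd_mono: "C \<subseteq> D \<Longrightarrow> closed_nbhd E C \<subseteq> closed_nbhd E D"
  by (auto simp: closed_nbhd_def)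

text \<open>Adjacency is symmetric, so no vertex of \<open>C\<close> has a neighbour outside
  \<open>closed_nbhd E C\<close>. Hence the far side is bounded by vertices of the boundary of
  \<open>C\<close> only.\<close>

lemma fragment_co:
  assumes "simple_graph V E" "fragment V E C"
  shows "fragment V E (V - closed_nbhd E C)" "boundary E (V - closed_nbhd E C) \<subseteq> boundary E C"
proof -
  let ?C = "V - closed_nbhd E C"
  have "closed_nbhd E C \<subset> V"
    using assms closed_nbhd_subset unfolding fragment_def by blast
  then have "?C \<noteq> {}" by auto
  have disj: "closed_nbhd E ?C \<inter> C = {}"
    by (auto simp: closed_nbhd_def) (metis insert_commute)
  then have "closed_nbhd E ?C \<noteq> V"
    using assms(2) unfolding fragment_def by blast
  with \<open>?C \<noteq> {}\<close> show "fragment V E ?C" by (auto simp: fragment_def)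
  show "boundary E ?C \<subseteq> boundary E C"
    using disj closed_nbhd_subset[OF assms(1), of ?C] by (auto simp: boundary_def)
qed

text \<open>
  By submodularity of \<open>C \<mapsto> card (closed_nbhd E C)\<close> a nonempty proper intersection would be a smaller
  atom, unless \<open>C \<union> D\<close> dominates \<open>V\<close>. In that case \<open>V\<close> would be too small: the complement of
  \<open>closed_nbhd E C\<close> is a fragment with boundary in that of \<open>C\<close>, so it has at least \<open>card C\<close> elements.
\<close>

lemma atoms_disjoint:
  assumes G: "simple_graph V E" and C: "atom V E C" and D: "atom V E D" and ne: "C \<inter> D \<noteq> {}"
  shows "C = D"
proof (rule ccontr)
  assume "C \<noteq> D"
  have finV: "finite V" using G by (simp add: simple_graph_def)
  have fC: "fragment V E C" and fD: "fragment V E D" using C D by (auto simp: atom_def)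
  then have sub: "C \<subseteq> V" "D \<subseteq> V" "C \<inter> D \<subseteq> V" "C \<union> D \<subseteq> V" by (auto simp: fragment_def)
  have fin: "finite C" "finite D" using sub finV finite_subset by blast+
  have same: "card (boundary E D) = card (boundary E C)" "card D = card C"
    using C D fC fD unfolding atom_def by (metis less_asym order.antisym less_irrefl)+
  have sub_cn: "closed_nbhd E C \<subseteq> V" "closed_nbhd E D \<subseteq> V"
    using closed_nbhd_subset[OF G] sub by auto
  have fin_cn: "finite (closed_nbhd E C)" "finite (closed_nbhd E D)"
    using sub_cn finV finite_subset by blast+
  have cI: "card (C \<inter> D) < card C"
    using \<open>C \<noteq> D\<close> same fin by (metis card_subset_eq inf_le1 inf_le2 le_neq_implies_less card_mono)
  have fI: "fragment V E (C \<inter> D)"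
    using fC ne sub sub_cn closed_nbhd_mono[of "C \<inter> D" C E] unfolding fragment_def by blast
  then have bI: "card (boundary E C) < card (boundary E (C \<inter> D))"
    using C cI unfolding atom_def by (meson not_less)
  have "closed_nbhd E (C \<inter> D) \<subseteq> closed_nbhd E C \<inter> closed_nbhd E D"
    using closed_nbhd_mono[of "C \<inter> D"] by (metis inf_le1 inf_le2 le_inf_iff)
  then have "card (closed_nbhd E (C \<inter> D)) \<le> card (closed_nbhd E C \<inter> closed_nbhd E D)"
    using fin_cn by (intro card_mono) auto
  then have I: "card (C \<inter> D) + card (boundary E C) < card (closed_nbhd E C \<inter> closed_nbhd E D)"
    using bI card_closed_nbhd[OF G sub(3)] by linarith
  have U: "card (closed_nbhd E (C \<union> D)) + card (closed_nbhd E C \<inter> closed_nbhd E D)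
      = 2 * card C + 2 * card (boundary E C)"
    using card_Un_Int[OF fin_cn] card_closed_nbhd[OF G sub(1)] card_closed_nbhd[OF G sub(2)] same
    by (simp add: closed_nbhd_Un)
  have CU: "card (C \<union> D) + card (C \<inter> D) = 2 * card C"
    using card_Un_Int[OF fin] same by simp
  show False
  proof (cases "closed_nbhd E (C \<union> D) = V")
    case True
    let ?C = "V - closed_nbhd E C"
    have "card (boundary E ?C) \<le> card (boundary E C)"
      using fragment_co(2)[OF G fC] fin_cn(1) by (intro card_mono) (auto simp: boundary_def)
    then have "card C \<le> card ?C"
      using C fragment_co(1)[OF G fC] unfolding atom_def by (meson not_less)
    moreover have "card V = card (closed_nbhd E C) + card ?C"
      using sub_cn(1) finV by (metis card_Diff_subset card_mono fin_cn(1) le_add_diff_inverse)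
    moreover have "card (closed_nbhd E (C \<union> D)) = card V" using True by simp
    ultimately show False
      using I U card_closed_nbhd[OF G sub(1)] by linarith
  next
    case False
    then have "fragment V E (C \<union> D)" using sub ne by (auto simp: fragment_def)
    then have "card (boundary E C) \<le> card (boundary E (C \<union> D))"
      using C unfolding atom_def by (metis less_imp_le order_refl)
    then show False
      using card_closed_nbhd[OF G sub(4)] I U CU by linarith
  qed
qed

text \<open>A component of the graph induced on \<open>V - S\<close> serves as \<open>C\<close>: it
  can be left only through \<open>S\<close>, and a vertex of another component stays outside its
  closed neighbourhood.\<close>

lemma fragment_of_separator:
  assumes G: "simple_graph V E" and S: "S \<subseteq> V" "V - S \<noteq> {}" "\<not> connected_on E (V - S)"
  shows "\<exists>C. fragment V E C \<and> boundary E C \<subseteq> S"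
proof -
  let ?r = "{(x, y). x \<in> V - S \<and> y \<in> V - S \<and> {x, y} \<in> E}"
  obtain u v where uv: "u \<in> V - S" "v \<in> V - S" "(u, v) \<notin> ?r\<^sup>*"
    using S(2,3) unfolding connected_on_def by blast
  define C where "C = {x \<in> V - S. (u, x) \<in> ?r\<^sup>*}"
  have sub: "closed_nbhd E C \<subseteq> C \<union> S"
  proof
    fix y assume y: "y \<in> closed_nbhd E C"
    show "y \<in> C \<union> S"
    proof (rule ccontr)
      assume n: "y \<notin> C \<union> S"
      then obtain c where c: "c \<in> C" "{c, y} \<in> E" using y by (auto simp: closed_nbhd_def)
      have "y \<in> V" using G c(2) by (auto simp: simple_graph_def)
      then have "(c, y) \<in> ?r" using c n by (auto simp: C_def)
      with c have "(u, y) \<in> ?r\<^sup>*" unfolding C_def by (blast intro: rtrancl_into_rtrancl)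
      then show False using n \<open>y \<in> V\<close> by (auto simp: C_def)
    qed
  qed
  moreover have "u \<in> C" "v \<notin> C \<union> S" using uv by (auto simp: C_def)
  ultimately have "fragment V E C" "boundary E C \<subseteq> S"
    using uv by (auto simp: fragment_def boundary_def C_def)
  then show ?thesis by blast
qed

section \<open>Quotients of the king's graph by a lattice\<close>

text \<open>The king's moves together with the null move, so that one step in \<open>box\<close>
  describes closed neighbourhoods.\<close>

definition box :: "(int \<times> int) set" where
  "box = {-1..1} \<times> {-1..1}"

text \<open>\<open>p\<close> is the quotient map of the integer grid. By \<open>shift\<close> its
  fibres are the cosets of one group of periods. The square in \<open>small\<close> consists of the
  differences of two vectors of \<open>box\<close>, so \<open>small\<close> keeps every translate of
  \<open>box\<close> injective under \<open>p\<close>.\<close>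

locale king_torus =
  fixes V :: "'a set" and E :: "'a set set" and p :: "int \<times> int \<Rightarrow> 'a"
  assumes graph: "simple_graph V E"
    and range_p: "range p = V"
    and shift: "p x = p y \<Longrightarrow> p (x + z) = p (y + z)"
    and edge: "{p z, v} \<in> E \<longleftrightarrow> (\<exists>w\<in>box. w \<noteq> 0 \<and> v = p (z + w))"
    and small: "w \<in> {-2..2} \<times> {-2..2} \<Longrightarrow> p (z + w) = p z \<Longrightarrow> w = 0"
begin

lemma finite_V: "finite V"
  using graph by (simp add: simple_graph_def)

lemma p_in_V [simp]: "p z \<in> V"
  using range_p by blast

lemma shift_iff: "p (x + z) = p (y + z) \<longleftrightarrow> p x = p y"
  using shift[of x y z] shift[of "x + z" "y + z" "- z"] by auto

lemma p_eq_iff: "p x = p y \<longleftrightarrow> p (x - y) = p 0"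
  using shift_iff[of x "- y" y] by simp

lemma set_eqI_p: "C \<subseteq> V \<Longrightarrow> D \<subseteq> V \<Longrightarrow> (\<And>z. p z \<in> C \<longleftrightarrow> p z \<in> D) \<Longrightarrow> C = D"
  using range_p by blast

lemma inj_on_box: "inj_on p box"
proof (rule inj_onI)
  fix x y assume "x \<in> box" "y \<in> box" "p x = p y"
  then have "x - y = 0"
    by (intro small[of "x - y" y]) (auto simp: box_def)
  then show "x = y" by simp
qed

lemma box_uminus: "w \<in> box \<Longrightarrow> - w \<in> box"
  by (auto simp: box_def)

lemma closed_nbhd_iff:
  "p z \<in> closed_nbhd E C \<longleftrightarrow> (\<exists>w\<in>box. p (z + w) \<in> C)"
proof -
  have "(\<exists>c\<in>C. {c, p z} \<in> E) \<longleftrightarrow> (\<exists>c\<in>C. \<exists>w\<in>box. w \<noteq> 0 \<and> c = p (z + w))"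
    using edge by (simp add: insert_commute)
  then have "p z \<in> closed_nbhd E C \<longleftrightarrow> p (z + 0) \<in> C \<or> (\<exists>w\<in>box. w \<noteq> 0 \<and> p (z + w) \<in> C)"
    by (auto simp: closed_nbhd_def)
  moreover have "0 \<in> box" by (simp add: box_def zero_prod_def)
  ultimately show ?thesis by metis
qed

text \<open>Translation by \<open>y\<close>, transported to \<open>V\<close>; by
  \<open>shift\<close> the chosen preimage does not matter.\<close>

definition tr :: "int \<times> int \<Rightarrow> 'a \<Rightarrow> 'a" where
  "tr y v = p (inv p v + y)"

lemma tr_p: "tr y (p z) = p (z + y)"
  unfolding tr_def by (metis UNIV_I f_inv_into_f image_eqI shift)

lemma tr_image_subset: "tr y ` C \<subseteq> V"
  by (auto simp: tr_def)

lemma mem_tr_image: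
  assumes "C \<subseteq> V"
  shows "p z \<in> tr y ` C \<longleftrightarrow> p (z - y) \<in> C"
proof
  assume "p z \<in> tr y ` C"
  then obtain c where c: "c \<in> C" "p z = tr y c" by blast
  then obtain x where "c = p x" using assms range_p by blast
  then have "p x \<in> C" "p z = p (x + y)" using c tr_p by auto
  then show "p (z - y) \<in> C" using shift_iff[of "z - y" y x] by simp
next
  assume "p (z - y) \<in> C"
  then show "p z \<in> tr y ` C" using tr_p[of y "z - y"] by (metis diff_add_cancel imageI)
qed

lemma inj_on_tr: "C \<subseteq> V \<Longrightarrow> inj_on (tr y) C"
proof (rule inj_onI)
  fix u v assume C: "C \<subseteq> V" "u \<in> C" "v \<in> C" and eq: "tr y u = tr y v"
  obtain a b where "u = p a" "v = p b" using C range_p by blast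
  then show "u = v" using eq by (simp add: tr_p shift_iff)
qed

lemma card_tr_image: "C \<subseteq> V \<Longrightarrow> card (tr y ` C) = card C"
  by (simp add: card_image inj_on_tr)

lemma closed_nbhd_tr:
  assumes "C \<subseteq> V"
  shows "closed_nbhd E (tr y ` C) = tr y ` closed_nbhd E C"
proof (rule set_eqI_p)
  show "closed_nbhd E (tr y ` C) \<subseteq> V"
    by (rule closed_nbhd_subset[OF graph tr_image_subset])
  fix z
  show "(p z \<in> closed_nbhd E (tr y ` C)) = (p z \<in> tr y ` closed_nbhd E C)"
    using assms closed_nbhd_subset[OF graph assms]
    by (simp add: mem_tr_image closed_nbhd_iff algebra_simps)
qed (rule tr_image_subset)

text \<open>Translations are automorphisms of the graph, so they preserve both quantities that an
  atom minimises.\<close>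

lemma atom_tr:
  assumes "atom V E C"
  shows "atom V E (tr y ` C)"
proof -
  have C: "C \<subseteq> V" "C \<noteq> {}" "closed_nbhd E C \<noteq> V"
    using assms by (auto simp: atom_def fragment_def)
  have cn: "closed_nbhd E C \<subseteq> V" using closed_nbhd_subset[OF graph C(1)] .
  have "card (closed_nbhd E C) < card V"
    using C(3) cn finite_V by (simp add: psubset_card_mono psubsetI)
  then have "closed_nbhd E (tr y ` C) \<noteq> V"
    using card_tr_image[OF cn] closed_nbhd_tr[OF C(1)] by (metis less_irrefl)
  then have "fragment V E (tr y ` C)"
    using C tr_image_subset by (auto simp: fragment_def)
  moreover have "card (boundary E (tr y ` C)) = card (boundary E C)"
    using card_closed_nbhd[OF graph C(1)] card_closed_nbhd[OF graph tr_image_subset, of y C]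
    by (simp add: closed_nbhd_tr[OF C(1)] card_tr_image[OF cn] card_tr_image[OF C(1)])
  ultimately show ?thesis
    using assms by (simp add: atom_def card_tr_image[OF C(1)])
qed

end

section \<open>The subgroup formed by an atom through the origin\<close>

locale king_torus_atom = king_torus +
  fixes H
  assumes atom: "atom V E H" and zero: "p 0 \<in> H" and small_boundary: "card (boundary E H) < 8"
begin

text \<open>The full preimage of \<open>H\<close> in the grid. The subgroup is handled here, with
  integer vectors, and \<open>V\<close> needs no group structure of its own.\<close>

definition L where "L = {z. p z \<in> H}"

lemma H_subset: "H \<subseteq> V" and cn_ne: "closed_nbhd E H \<noteq> V"
  using atom by (auto simp: atom_def fragment_def)

text \<open>The translate of \<open>H\<close> by \<open>x\<close> is again an atom and shares
  \<open>p x\<close> with \<open>H\<close>, so it equals \<open>H\<close>.\<close>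

lemma diff_L: "z - x \<in> L" if "x \<in> L" "z \<in> L"
proof -
  have "p x \<in> tr x ` H" using zero mem_tr_image[OF H_subset, of x x] by simp
  moreover have "p x \<in> H" using that(1) by (simp add: L_def)
  ultimately have "tr x ` H = H"
    using atoms_disjoint[OF graph atom_tr[OF atom] atom] by blast
  then show ?thesis
    using that(2) mem_tr_image[OF H_subset, of z x] by (simp add: L_def)
qed

lemma zero_L: "0 \<in> L" using zero by (simp add: L_def)

lemma uminus_L: "x \<in> L \<Longrightarrow> - x \<in> L" using diff_L[of x 0] zero_L by simp

lemma add_L: "x \<in> L \<Longrightarrow> y \<in> L \<Longrightarrow> x + y \<in> L" using diff_L[of "- x" y] uminus_L by (simp add: add.commute)

definition mul :: "int \<Rightarrow> int \<times> int \<Rightarrow> int \<times> int" where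
  "mul k z = (k * fst z, k * snd z)"

lemma mul_L: "x \<in> L \<Longrightarrow> mul k x \<in> L"
proof (induction k rule: int_induct[where k = 0])
  case base
  then show ?case using zero_L by (simp add: mul_def zero_prod_def)
next
  case (step1 i)
  have "mul (i + 1) x = mul i x + x" by (simp add: mul_def prod_eq_iff algebra_simps)
  then show ?case using step1 add_L by simp
next
  case (step2 i)
  have "mul (i - 1) x = mul i x - x" by (simp add: mul_def prod_eq_iff algebra_simps)
  then show ?case using step2 diff_L by simp
qed

text \<open>If every grid point were one king's step away from \<open>L\<close>, then
  \<open>H\<close> would dominate \<open>V\<close> and could not be a fragment. The case analysis
  below draws its contradictions from this.\<close>

lemma not_cover: "(\<And>z. \<exists>w\<in>box. z + w \<in> L) \<Longrightarrow> False"
  using cn_ne set_eqI_p[OF closed_nbhd_subset[OF graph H_subset] subset_refl]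
  by (simp add: closed_nbhd_iff L_def)

definition cosets where "cosets = (\<lambda>w. tr w ` H) ` box"

lemma coset_eq_iff: "tr w ` H = tr w' ` H \<longleftrightarrow> w - w' \<in> L"
proof
  assume "tr w ` H = tr w' ` H"
  then have "p w \<in> tr w' ` H" using zero mem_tr_image[OF H_subset, of w w] by simp
  then show "w - w' \<in> L" by (simp add: mem_tr_image[OF H_subset] L_def)
next
  assume *: "w - w' \<in> L"
  have "z - w \<in> L \<longleftrightarrow> z - w' \<in> L" for z
    using add_L[OF *, of "z - w"] diff_L[OF *, of "z - w'"] by auto
  then show "tr w ` H = tr w' ` H"
    by (intro set_eqI_p tr_image_subset) (simp add: mem_tr_image[OF H_subset] L_def)
qed

lemma finite_box: "finite box" and card_box: "card box = 9"
  by (simp_all add: box_def)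

lemma finite_cosets: "finite cosets"
  by (simp add: cosets_def finite_box)

lemma card_closed_nbhd_H: "card (closed_nbhd E H) = card cosets * card H"
proof -
  have U: "closed_nbhd E H = \<Union> cosets"
  proof (rule set_eqI_p[OF closed_nbhd_subset[OF graph H_subset]])
    show "\<Union> cosets \<subseteq> V" unfolding cosets_def using tr_image_subset by blast
    fix z
    have "(\<exists>w\<in>box. p (z + w) \<in> H) \<longleftrightarrow> (\<exists>w\<in>box. p (z - w) \<in> H)"
    proof safe
      fix w assume "w \<in> box" "p (z + w) \<in> H"
      then show "\<exists>w\<in>box. p (z - w) \<in> H" using box_uminus by (intro bexI[of _ "- w"]) auto
    next
      fix w assume "w \<in> box" "p (z - w) \<in> H"
      then show "\<exists>w\<in>box. p (z + w) \<in> H" using box_uminus by (intro bexI[of _ "- w"]) auto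
    qed
    then show "p z \<in> closed_nbhd E H \<longleftrightarrow> p z \<in> \<Union> cosets"
      by (simp add: closed_nbhd_iff cosets_def mem_tr_image[OF H_subset])
  qed
  have "card H * card cosets = card (\<Union> cosets)"
  proof (rule card_partition[OF finite_cosets])
    show "finite (\<Union> cosets)"
      using U closed_nbhd_subset[OF graph H_subset] finite_V finite_subset by metis
    show "card c = card H" if "c \<in> cosets" for c
      using that card_tr_image[OF H_subset] by (auto simp: cosets_def)
    show "c \<inter> c' = {}" if cc: "c \<in> cosets" "c' \<in> cosets" "c \<noteq> c'" for c c'
    proof (rule ccontr)
      assume "c \<inter> c' \<noteq> {}"
      moreover obtain w w' where w: "c = tr w ` H" "c' = tr w' ` H"
        using cc unfolding cosets_def by blast
      ultimately obtain v where v: "v \<in> tr w ` H" "v \<in> tr w' ` H" by blast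
      then obtain z where "v = p z" using range_p tr_image_subset by blast
      then have "z - w \<in> L" "z - w' \<in> L"
        using v mem_tr_image[OF H_subset] by (auto simp: L_def)
      then have "w - w' \<in> L" using diff_L by fastforce
      then show False using cc w coset_eq_iff by simp
    qed
  qed
  then show ?thesis using U by (simp add: mult.commute)
qed

lemma card_cases: "card cosets \<le> 2 \<and> 5 \<le> card H \<or> card cosets = 3 \<and> card H = 3"
proof -
  have "p ` box \<subseteq> closed_nbhd E H"
  proof
    fix v assume "v \<in> p ` box"
    then obtain w where "w \<in> box" "v = p w" by auto
    then show "v \<in> closed_nbhd E H"
      using closed_nbhd_iff[of w H] box_uminus[of w] zero by force
  qed
  moreover have fin: "finite (closed_nbhd E H)"
    using closed_nbhd_subset[OF graph H_subset] finite_V finite_subset by metis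
  ultimately have 9: "9 \<le> card cosets * card H"
    using card_mono[of "closed_nbhd E H" "p ` box"] card_image[OF inj_on_box] card_box card_closed_nbhd_H by simp
  have b: "card cosets * card H < card H + 8"
    using card_closed_nbhd[OF graph H_subset] card_closed_nbhd_H small_boundary by simp
  have "card cosets \<le> 3"
  proof (rule ccontr)
    assume "\<not> card cosets \<le> 3"
    then have "4 * card H \<le> card cosets * card H" by (intro mult_right_mono) auto
    then have "card H \<le> 2" using b by linarith
    then consider "card H = 0" | "card H = 1" | "card H = 2" by linarith
    then show False using 9 b by cases auto
  qed
  then consider "card cosets = 0" | "card cosets = 1" | "card cosets = 2" | "card cosets = 3" by linarith
  then show ?thesis using 9 b by cases auto
qed

lemma pigeonhole_cosets:
  assumes "W \<subseteq> box" "card cosets < card W"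
  shows "\<exists>x\<in>W. \<exists>y\<in>W. x \<noteq> y \<and> x - y \<in> L"
proof -
  have "card ((\<lambda>w. tr w ` H) ` W) \<le> card cosets"
    using assms(1) finite_cosets unfolding cosets_def by (intro card_mono) auto
  then have "\<not> inj_on (\<lambda>w. tr w ` H) W"
    using assms(2) card_image by fastforce
  then show ?thesis using coset_eq_iff unfolding inj_on_def by blast
qed


definition basis :: "int \<times> int \<Rightarrow> int \<times> int \<Rightarrow> bool" where
  "basis e f \<longleftrightarrow> (e, f) \<in> {((1, 0), (0, 1)), ((0, 1), (1, 0))}"

lemma basis_box:
  assumes "basis e f"
  shows "0 \<in> box" "e \<in> box" "- e \<in> box" "f \<in> box" "- f \<in> box" "e + f \<in> box" "e - f \<in> box"
    "basis f e"
  using assms by (auto simp: basis_def box_def zero_prod_def)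

lemma basis_repr: "basis e f \<Longrightarrow> \<exists>i j. z = mul i e + mul j f"
  by (cases z) (auto simp: basis_def mul_def)

lemma mul_simps:
  "mul (i - j) x = mul i x - mul j x" "mul 0 x = 0" "mul 1 x = x"
  by (auto simp: mul_def prod_eq_iff algebra_simps)

text \<open>Modulo \<open>s e + f\<close> every vector is a multiple of \<open>e\<close>, and modulo
  \<open>3 e\<close> the coefficient can be taken from -1, 0, 1. Hence \<open>L\<close> is always
  one step along \<open>e\<close> away, or none.\<close>

lemma cover_if_mod3:
  assumes "basis e f" "mul 3 e \<in> L" "mul s e + f \<in> L"
  shows False
proof (rule not_cover)
  fix z
  obtain i j where z: "z = mul i e + mul j f" using basis_repr[OF assms(1)] by blast
  define m where "m = i - j * s"
  \<comment> \<open>The balanced remainder of \<open>m\<close> modulo 3; the ordinary remainder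
    could be 2, which is too long for \<open>box\<close>.\<close>
  define k where "k = (m + 1) mod 3 - 1"
  define q where "q = (m + 1) div 3"
  have k: "k \<in> {-1, 0, 1}" unfolding k_def by auto
  have "m = q * 3 + k"
    using div_mult_mod_eq[of "m + 1" 3] unfolding q_def k_def by linarith
  then have "i = q * 3 + k + j * s" by (simp add: m_def)
  then have "z + mul (- k) e = mul q (mul 3 e) + mul j (mul s e + f)"
    unfolding z by (simp add: mul_def prod_eq_iff algebra_simps)
  then have "z + mul (- k) e \<in> L" using assms(2,3) add_L mul_L by simp
  moreover have "mul (- k) e \<in> box" using k assms(1) by (auto simp: basis_def box_def mul_def)
  ultimately show "\<exists>w\<in>box. z + w \<in> L" by blast
qed

lemma cover_if_mod2:
  assumes "basis e f" "mul 2 e \<in> L" "mul s e + f \<in> L"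
  shows False
proof (rule not_cover)
  fix z
  obtain i j where z: "z = mul i e + mul j f" using basis_repr[OF assms(1)] by blast
  define m where "m = i - j * s"
  define k where "k = m mod 2"
  define q where "q = m div 2"
  have k: "k \<in> {0, 1}" unfolding k_def by auto
  have "m = q * 2 + k"
    using div_mult_mod_eq[of "m" 2] unfolding q_def k_def by linarith
  then have "i = q * 2 + k + j * s" by (simp add: m_def)
  then have "z + mul (- k) e = mul q (mul 2 e) + mul j (mul s e + f)"
    unfolding z by (simp add: mul_def prod_eq_iff algebra_simps)
  then have "z + mul (- k) e \<in> L" using assms(2,3) add_L mul_L by simp
  moreover have "mul (- k) e \<in> box" using k assms(1) by (auto simp: basis_def box_def mul_def)
  ultimately show "\<exists>w\<in>box. z + w \<in> L" by blast
qed

lemma card_cosets_le: "card cosets \<le> 3"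
  using card_cases by auto

lemma two_in_four:
  assumes "basis e f" "a \<in> box" "b \<in> box" "c \<in> box" "d \<in> box" "distinct [a, b, c, d]"
  shows "a - b \<in> L \<or> a - c \<in> L \<or> a - d \<in> L \<or> b - c \<in> L \<or> b - d \<in> L \<or> c - d \<in> L"
proof -
  have "card {a, b, c, d} = 4" using assms(6) by simp
  then have "\<exists>x\<in>{a, b, c, d}. \<exists>y\<in>{a, b, c, d}. x \<noteq> y \<and> x - y \<in> L"
    using assms card_cosets_le by (intro pigeonhole_cosets) simp_all
  then obtain x y where "x \<in> {a, b, c, d}" "y \<in> {a, b, c, d}" "x \<noteq> y" "x - y \<in> L"
    by blast
  moreover have "y - x \<in> L" using uminus_L[OF \<open>x - y \<in> L\<close>] by simp
  ultimately show ?thesis by blast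
qed

text \<open>Here 0, \<open>e\<close>, \<open>- e\<close> represent three different cosets, hence all
  of them. Placing \<open>f\<close> gives \<open>e - f\<close> or \<open>e + f\<close> in
  \<open>L\<close>; placing the other one of these two vectors then forces \<open>3 e\<close> into
  \<open>L\<close>, and \<open>L\<close> comes within one step of everything.\<close>

lemma twice_not_L:
  assumes b: "basis e f" and e: "e \<notin> L" and f: "f \<notin> L" and e2: "mul 2 e \<notin> L"
  shows False
proof -
  have L: "- x \<in> L \<longleftrightarrow> x \<in> L" for x using uminus_L[of x] uminus_L[of "- x"] by auto
  have m: "mul (-1) e = - e" "mul 2 e = e + e" "mul 3 e = e + e + e"
    by (auto simp: mul_def prod_eq_iff)
  have be: "e = (1, 0) \<and> f = (0, 1) \<or> e = (0, 1) \<and> f = (1, 0)"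
    using b by (simp add: basis_def)
  have d: "distinct [0, e, - e, f]" "distinct [0, e, - e, e + f]" "distinct [0, e, - e, e - f]"
    using be by (elim disjE; simp add: zero_prod_def)+
  have "0 - e \<notin> L" "0 - (- e) \<notin> L" "0 - f \<notin> L" "e - (- e) \<notin> L"
    using e f e2 by (simp_all add: L m)
  moreover have "- e - f = - (e + f)" by simp
  ultimately have "e - f \<in> L \<or> e + f \<in> L"
    using two_in_four[OF b basis_box(1-4)[OF b] d(1)] L by metis
  then show False
  proof
    assume ef: "e - f \<in> L"
    have n: "e + f \<notin> L" using e2 m add_L[of "e - f" "e + f"] ef by auto
    have "0 - e \<notin> L" "0 - (- e) \<notin> L" "0 - (e + f) \<notin> L" "e - (- e) \<notin> L" "e - (e + f) \<notin> L"
      using e f e2 n L[of "e + f"] by (simp_all add: L m)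
    moreover have "- e - (e + f) = - (e + e + f)" by simp
    ultimately have "e + e + f \<in> L"
      using two_in_four[OF b basis_box(1-3)[OF b] basis_box(6)[OF b] d(2)] L by metis
    then have "mul 3 e \<in> L" using add_L[OF _ ef, of "e + e + f"] by (simp add: m)
    moreover have "mul (-1) e + f \<in> L" using uminus_L[OF ef] by (simp add: m)
    ultimately show False by (rule cover_if_mod3[OF b])
  next
    assume ef: "e + f \<in> L"
    have n: "e - f \<notin> L" using e2 m add_L[of "e + f" "e - f"] ef by auto
    have "0 - (e - f) = - (e - f)" by simp
    then have "0 - e \<notin> L" "0 - (- e) \<notin> L" "0 - (e - f) \<notin> L" "e - (- e) \<notin> L" "e - (e - f) \<notin> L"
      using e f e2 n L by (simp_all add: m del: minus_diff_eq)
    moreover have "- e - (e - f) = - (e + e - f)" by simp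
    ultimately have "e + e - f \<in> L"
      using two_in_four[OF b basis_box(1-3)[OF b] basis_box(7)[OF b] d(3)] L by metis
    then have "mul 3 e \<in> L" using add_L[OF _ ef, of "e + e - f"] by (simp add: m)
    moreover have "mul 1 e + f \<in> L" using ef by (simp add: mul_simps)
    ultimately show False by (rule cover_if_mod3[OF b])
  qed
qed

text \<open>Otherwise \<open>2 e\<close> and \<open>2 f\<close> lie in \<open>L\<close> by the
  preceding lemma. Two of 0, \<open>e\<close>, \<open>f\<close>, \<open>e + f\<close> share a coset,
  which puts \<open>e + f\<close> or \<open>e - f\<close> into \<open>L\<close>; these agree modulo
  \<open>2 f\<close>, and \<open>e + f\<close> with \<open>2 e\<close> leaves no point
  uncovered.\<close>

lemma generator_in_L:
  assumes b: "basis e f"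
  shows "e \<in> L \<or> f \<in> L"
proof (rule ccontr)
  assume "\<not> ?thesis"
  then have e: "e \<notin> L" and f: "f \<notin> L" by auto
  have e2: "mul 2 e \<in> L" using twice_not_L[OF b e f] by blast
  have f2: "mul 2 f \<in> L" using twice_not_L[OF basis_box(8)[OF b] f e] by blast
  have "e = (1, 0) \<and> f = (0, 1) \<or> e = (0, 1) \<and> f = (1, 0)"
    using b by (simp add: basis_def)
  then have d: "distinct [0, e, f, e + f]"
    by (elim disjE; simp add: zero_prod_def)
  have "0 - x \<in> L \<longleftrightarrow> x \<in> L" for x using uminus_L[of x] uminus_L[of "- x"] by auto
  moreover have "e - (e + f) = 0 - f" "f - (e + f) = 0 - e" by simp_all
  ultimately have "e - f \<in> L \<or> e + f \<in> L"
    using two_in_four[OF b basis_box(1,2,4,6)[OF b] d] e f by metis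
  moreover have "e - f + mul 2 f = e + f" by (simp add: mul_def prod_eq_iff)
  ultimately have "e + f \<in> L"
    using add_L[OF _ f2, of "e - f"] by metis
  then show False using cover_if_mod2[OF b e2, of 1] by (simp add: mul_simps)
qed

text \<open>With at most two cosets, two of 0, \<open>f\<close>, \<open>- f\<close> agree modulo
  \<open>L\<close>, so \<open>2 f\<close> is in \<open>L\<close>. Together with \<open>e\<close>
  this brings every grid point within one step of \<open>L\<close>.\<close>

lemma card_eq_3:
  assumes b: "basis e f" and e: "e \<in> L"
  shows "card cosets = 3 \<and> card H = 3"
proof (rule ccontr)
  assume "\<not> ?thesis"
  then have le: "card cosets \<le> 2" using card_cases by auto
  have "card {0, f, - f} = 3" "{0, f, - f} \<subseteq> box"
    using b unfolding basis_def by (auto simp: zero_prod_def box_def)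
  then have "\<exists>x\<in>{0, f, - f}. \<exists>y\<in>{0, f, - f}. x \<noteq> y \<and> x - y \<in> L"
    using le by (intro pigeonhole_cosets) simp_all
  then obtain x y where "x \<in> {0, f, - f}" "y \<in> {0, f, - f}" "x \<noteq> y" "x - y \<in> L"
    by blast
  moreover have "y - x \<in> L" using uminus_L[OF \<open>x - y \<in> L\<close>] by simp
  moreover have "mul 2 f = f + f" by (simp add: mul_def prod_eq_iff)
  ultimately have "mul 2 f \<in> L \<or> f \<in> L" using uminus_L[of "- f"] by auto
  then have "mul 2 f \<in> L" using mul_L by blast
  then show False
    using cover_if_mod2[OF basis_box(8)[OF b], of 0] e by (simp add: mul_simps)
qed

text \<open>The multiples of \<open>e\<close> by 0, 1, 2, 3 all map into the three-element set
  \<open>H\<close>, so two coincide. Their difference is \<open>e\<close>, \<open>2 e\<close> or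
  \<open>3 e\<close> up to sign, and \<open>small\<close> excludes the first two.\<close>

lemma period_3:
  assumes b: "basis e f" and e: "e \<in> L"
  shows "p (mul 3 e) = p 0"
proof -
  have H: "card H = 3" using card_eq_3[OF assms] by simp
  let ?f = "\<lambda>k. p (mul k e)"
  have "?f ` {0, 1, 2, 3} \<subseteq> H" using mul_L[OF e] by (auto simp: L_def)
  then have "card (?f ` {0, 1, 2, 3}) \<le> 3"
    using H card_mono[of H] finite_V H_subset finite_subset by metis
  then have "\<not> inj_on ?f {0, 1, 2, 3}"
    using card_image by fastforce
  then obtain k l where kl: "k \<in> {0, 1, 2, 3}" "l \<in> {0, 1, 2, 3}" "k \<noteq> l" "p (mul k e) = p (mul l e)"
    unfolding inj_on_def by blast
  then have eq: "p (mul (k - l) e) = p 0" "p (mul (l - k) e) = p 0"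
    using p_eq_iff[of "mul k e" "mul l e"] p_eq_iff[of "mul l e" "mul k e"] by (simp_all add: mul_simps)
  define j where "j = \<bar>k - l\<bar>"
  have "p (mul j e) = p 0" using eq by (cases "l \<le> k") (simp_all add: j_def abs_if)
  moreover have "j = 1 \<or> j = 2 \<or> j = 3" using kl(1-3) unfolding j_def by auto
  moreover have "mul j e \<noteq> 0 \<and> mul j e \<in> {-2..2} \<times> {-2..2}" if "j = 1 \<or> j = 2" for j
    using that b by (auto simp: mul_def basis_def zero_prod_def)
  then have "p (mul j e) \<noteq> p 0" if "j = 1 \<or> j = 2" for j
    using that small[of "mul j e" 0] by fastforce
  ultimately show ?thesis by blast
qed

lemma card_boundary: "card (boundary E H) = 6"
  and card_V: "10 \<le> card V"
  and short_period: "p (3, 0) = p 0 \<or> p (0, 3) = p 0"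
proof -
  have b: "basis (1, 0) (0, 1)" "basis (0, 1) (1, 0)" by (auto simp: basis_def)
  have "card cosets = 3 \<and> card H = 3"
    using generator_in_L[OF b(1)] card_eq_3[OF b(1)] card_eq_3[OF b(2)] by blast
  then have 9: "card (closed_nbhd E H) = 9" using card_closed_nbhd_H by simp
  then show "card (boundary E H) = 6"
    using card_closed_nbhd[OF graph H_subset] \<open>card cosets = 3 \<and> card H = 3\<close> by simp
  have "closed_nbhd E H \<subset> V"
    using closed_nbhd_subset[OF graph H_subset] cn_ne by blast
  then show "10 \<le> card V" using 9 psubset_card_mono[OF finite_V, of "closed_nbhd E H"] by simp
  have "p (mul 3 (1, 0)) = p 0 \<or> p (mul 3 (0, 1)) = p 0"
    using generator_in_L[OF b(1)] period_3[OF b(1)] period_3[OF b(2)] by blast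
  then show "p (3, 0) = p 0 \<or> p (0, 3) = p 0" by (simp add: mul_def)
qed

end

section \<open>Connectivity of the quotient graph\<close>

context king_torus
begin

lemma small_boundary:
  assumes C: "fragment V E C" and b: "card (boundary E C) < 8"
  shows "6 \<le> card (boundary E C) \<and> 10 \<le> card V \<and> (p (3, 0) = p 0 \<or> p (0, 3) = p 0)"
proof -
  obtain A where A: "atom V E A" using exists_atom[OF C] by blast
  then obtain v where v: "v \<in> A" "A \<subseteq> V" unfolding atom_def fragment_def by blast
  then obtain x where x: "v = p x" using range_p by blast
  let ?H = "tr (- x) ` A"
  have H: "atom V E ?H" using atom_tr[OF A] .
  then have le: "card (boundary E ?H) \<le> card (boundary E C)"
    using C unfolding atom_def by (metis less_imp_le order_refl)
  have "p 0 \<in> ?H" using mem_tr_image[OF v(2), of 0 "- x"] v x by simp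
  then interpret king_torus_atom V E p ?H
    using H le b by unfold_locales simp_all
  show ?thesis using card_boundary card_V short_period le by simp
qed

lemma small_separator:
  assumes S: "S \<subseteq> V" "card S < 8" "V - S \<noteq> {}" "\<not> connected_on E (V - S)"
  shows "6 \<le> card S \<and> 10 \<le> card V \<and> (p (3, 0) = p 0 \<or> p (0, 3) = p 0)"
proof -
  obtain C where C: "fragment V E C" "boundary E C \<subseteq> S"
    using fragment_of_separator[OF graph S(1,3,4)] by blast
  then have "card (boundary E C) \<le> card S"
    using S(1) finite_V finite_subset by (metis card_mono)
  then show ?thesis using small_boundary[OF C(1)] S(2) by linarith
qed

lemma card_V_ge: "9 \<le> card V"
proof -
  have "card (p ` box) = 9" using card_image[OF inj_on_box] by (simp add: box_def)
  moreover have "card (p ` box) \<le> card V"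
    by (rule card_mono[OF finite_V]) (simp add: image_subset_iff)
  ultimately show ?thesis by simp
qed

lemma k_connected_8_or_6:
  "k_connected V E 8 \<or> k_connected V E 6 \<and> 10 \<le> card V \<and> (p (3, 0) = p 0 \<or> p (0, 3) = p 0)"
proof (cases "k_connected V E 8")
  case False
  \<comment> \<open>\<open>connected_on\<close> is false on the empty set, so a failure of
    connectedness yields a genuine separation only once something is known to remain.\<close>
  have ne: "V - S \<noteq> {}" if "S \<subseteq> V" "card S < 8" for S
    using that card_V_ge by auto
  obtain S where S: "S \<subseteq> V" "card S < 8" "\<not> connected_on E (V - S)"
    using False card_V_ge unfolding k_connected_def by auto
  have "connected_on E (V - T)" if "T \<subseteq> V" "card T < 6" for T
    using small_separator[OF that(1) _ ne] that by fastforce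
  then have "k_connected V E 6" using card_V_ge unfolding k_connected_def by auto
  then show ?thesis using small_separator[OF S(1,2) ne[OF S(1,2)] S(3)] by blast
qed simp

lemma not_connected_onI:
  assumes C: "u \<in> C" "u \<in> W" "v \<in> W" "v \<notin> C"
    and closed: "\<And>x y. x \<in> C \<Longrightarrow> x \<in> W \<Longrightarrow> y \<in> W \<Longrightarrow> {x, y} \<in> E \<Longrightarrow> y \<in> C"
  shows "\<not> connected_on E W"
proof
  assume "connected_on E W"
  then have "(u, v) \<in> {(x, y). x \<in> W \<and> y \<in> W \<and> {x, y} \<in> E}\<^sup>*"
    using C unfolding connected_on_def by blast
  then have "v \<in> C"
    by (induction rule: rtrancl_induct) (use C closed in auto)
  then show False using C by blast
qed

text \<open>Deleting the at most eight neighbours of \<open>p 0\<close> isolates it. The clause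
  \<open>k < card V\<close> in \<open>k_connected\<close> supplies a tenth vertex to be separated
  from it.\<close>

lemma not_k_connected_9:
  assumes "9 \<le> k"
  shows "\<not> k_connected V E k"
proof
  assume k: "k_connected V E k"
  let ?S = "p ` (box - {0})"
  have "card ?S \<le> card (box - {0})" by (rule card_image_le) (simp add: box_def)
  then have S: "card ?S \<le> 8" by (simp add: box_def zero_prod_def)
  then have c: "connected_on E (V - ?S)"
    using k assms unfolding k_connected_def by (auto simp: image_subset_iff)
  have p0: "p 0 \<notin> ?S"
    using small[of _ 0] by (force simp: box_def)
  have "card (insert (p 0) ?S) \<le> 9"
    using S p0 by (simp add: box_def)
  moreover have "10 \<le> card V" using k assms by (simp add: k_connected_def)
  ultimately obtain v where v: "v \<in> V" "v \<notin> insert (p 0) ?S"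
    using card_mono[of "insert (p 0) ?S" V] by (fastforce simp: box_def)
  have "\<not> connected_on E (V - ?S)"
  proof (rule not_connected_onI[of "p 0" "{p 0}" _ v])
    fix x y assume "x \<in> {p 0}" "y \<in> V - ?S" "{x, y} \<in> E"
    then show "y \<in> {p 0}" using edge[of 0 y] by auto
  qed (use v p0 in auto)
  then show False using c by blast
qed

lemma not_k_connected_7:
  assumes per: "p (3, 0) = p 0" and V: "10 \<le> card V" and k: "7 \<le> k"
  shows "\<not> k_connected V E k"
proof
  assume kc: "k_connected V E k"
  have red: "p (a, b) = p (a mod 3, b)" for a b
  proof -
    have "p (3 * i, 0) = p 0" for i
    proof (induction i rule: int_induct[where k = 0])
      case (step1 i)
      then show ?case using shift[of "(3 * i, 0)" 0 "(3, 0)"] per by (simp add: algebra_simps)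
    next
      case (step2 i)
      then show ?case
        using p_eq_iff[of "(3 * i, 0)" "(3, 0)"] per by (simp add: algebra_simps)
    qed (simp add: zero_prod_def)
    from shift[OF this[of "a div 3"], of "(a mod 3, b)"] show ?thesis by simp
  qed
  have m3: "a mod 3 \<in> {0, 1, 2}" for a :: int by auto
  \<comment> \<open>Removing the two 3-cycles next to the row of \<open>p 0\<close> isolates that row.\<close>
  let ?S = "p ` ({0, 1, 2} \<times> {-1, 1})"
  have "card ?S \<le> card ({0, 1, 2 :: int} \<times> {-1, 1 :: int})" by (rule card_image_le) simp
  then have S: "card ?S \<le> 6" by simp
  then have c: "connected_on E (V - ?S)"
    using kc k unfolding k_connected_def by (auto simp: image_subset_iff)
  have inS: "p (a, b) \<in> ?S" if "b = 1 \<or> b = -1" for a b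
  proof -
    have "(a mod 3, b) \<in> {0, 1, 2} \<times> {-1, 1}" using m3[of a] that by auto
    then show ?thesis by (subst red) (rule imageI)
  qed
  \<comment> \<open>The three rows around \<open>p 0\<close> contain at most nine vertices, so ten
    vertices guarantee one beyond the two deleted rows.\<close>
  let ?T = "p ` ({0, 1, 2} \<times> {-1, 0, 1})"
  have "card ?T \<le> card ({0, 1, 2 :: int} \<times> {-1, 0, 1 :: int})" by (rule card_image_le) simp
  then have "card ?T \<le> 9" by simp
  then obtain v where v: "v \<in> V" "v \<notin> ?T"
    using card_mono[of ?T V] V by fastforce
  have "\<not> connected_on E (V - ?S)"
  proof (rule not_connected_onI[of "p 0" "range (\<lambda>a. p (a, 0))" _ v])
    show "p 0 \<in> range (\<lambda>a. p (a, 0))" by (simp add: zero_prod_def)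
    have "p 0 \<notin> ?S"
    proof
      assume "p 0 \<in> ?S"
      then obtain w where w: "w \<in> {0, 1, 2} \<times> {-1, 1}" "p 0 = p w" by blast
      then have "w = 0" using small[of w 0] by fastforce
      then show False using w by (auto simp: zero_prod_def)
    qed
    then show "p 0 \<in> V - ?S" by simp
    show "v \<in> V - ?S" using v by blast
    show "v \<notin> range (\<lambda>a. p (a, 0))"
    proof
      assume "v \<in> range (\<lambda>a. p (a, 0))"
      then obtain a where "v = p (a mod 3, 0)" using red by auto
      moreover have "(a mod 3, 0) \<in> {0, 1, 2} \<times> {-1, 0, 1}" using m3[of a] by auto
      ultimately show False using v(2) by (metis imageI)
    qed
    fix x y assume "x \<in> range (\<lambda>a. p (a, 0))" "y \<in> V - ?S" "{x, y} \<in> E"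
    then obtain a w where aw: "w \<in> box" "y = p ((a, 0) + w)"
      using edge by blast
    obtain i j where w: "w = (i, j)" by fastforce
    then have "j = -1 \<or> j = 0 \<or> j = 1" using aw by (auto simp: box_def)
    note w = w this
    then have "y = p (a + i, j)" using aw by simp
    then have "j = 0" using inS[of j "a + i"] \<open>y \<in> V - ?S\<close> w(2) by (metis DiffD2)
    then show "y \<in> range (\<lambda>a. p (a, 0))" using aw w by auto
  qed
  then show False using c by blast
qed

end

section \<open>Developing the square grid onto a quadrangulation\<close>

text \<open>Integer powers of a permutation of \<open>D\<close>. The inverse \<open>g\<close> is
  passed explicitly because \<open>f\<close> is controlled only on \<open>D\<close>.\<close>

definition ipow :: "('d \<Rightarrow> 'd) \<Rightarrow> ('d \<Rightarrow> 'd) \<Rightarrow> int \<Rightarrow> 'd \<Rightarrow> 'd" where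
  "ipow f g k = (if 0 \<le> k then f ^^ nat k else g ^^ nat (- k))"

lemma ipow_in:
  assumes "\<And>y. y \<in> D \<Longrightarrow> f y \<in> D" "\<And>y. y \<in> D \<Longrightarrow> g y \<in> D" "x \<in> D"
  shows "ipow f g k x \<in> D"
proof -
  have "(f ^^ n) x \<in> D" "(g ^^ n) x \<in> D" for n
    by (induction n) (use assms in auto)
  then show ?thesis by (simp add: ipow_def)
qed

lemma ipow_step:
  assumes "\<And>y. y \<in> D \<Longrightarrow> g y \<in> D" "\<And>y. y \<in> D \<Longrightarrow> f (g y) = y" "x \<in> D"
  shows "f (ipow f g k x) = ipow f g (k + 1) x"
proof (cases "0 \<le> k")
  case True
  then have "nat (k + 1) = Suc (nat k)" by simp
  then show ?thesis using True by (simp add: ipow_def)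
next
  case False
  have "(g ^^ n) x \<in> D" for n
    by (induction n) (use assms in auto)
  moreover have "nat (- k) = Suc (nat (- (k + 1)))" using False by simp
  ultimately have "f (ipow f g k x) = (g ^^ nat (- (k + 1))) x"
    using False assms(2) by (simp add: ipow_def)
  also have "\<dots> = ipow f g (k + 1) x"
    using False by (cases "k = -1") (simp_all add: ipow_def)
  finally show ?thesis .
qed

lemma ipow_commute:
  assumes "\<And>y. y \<in> D \<Longrightarrow> f y \<in> D" "\<And>y. y \<in> D \<Longrightarrow> g y \<in> D" "x \<in> D"
    and "\<And>y. y \<in> D \<Longrightarrow> h (f y) = f (h y)" "\<And>y. y \<in> D \<Longrightarrow> h (g y) = g (h y)"
  shows "h (ipow f g k x) = ipow f g k (h x)"
proof -
  have "(f ^^ n) x \<in> D \<and> h ((f ^^ n) x) = (f ^^ n) (h x)" for n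
    by (induction n) (use assms in auto)
  moreover have "(g ^^ n) x \<in> D \<and> h ((g ^^ n) x) = (g ^^ n) (h x)" for n
    by (induction n) (use assms in auto)
  ultimately show ?thesis by (simp add: ipow_def)
qed

text \<open>
  \<open>R\<close> turns a dart about its tail and \<open>J\<close> reverses it. Going twice along the face next to \<open>d\<close>,
  \<open>J (R (J d))\<close> has the opposite corner of this face as its tail, so \<open>edge\<close> describes the sides and
  the diagonals of the faces.
\<close>

locale square_map =
  fixes V :: "'a set" and E :: "'a set set" and D :: "'d set"
    and R J :: "'d \<Rightarrow> 'd" and t :: "'d \<Rightarrow> 'a"
  assumes graph: "simple_graph V E" and conn: "connected_on E V" and reg: "regular V E 8"
    and R_in [simp]: "d \<in> D \<Longrightarrow> R d \<in> D" and J_in [simp]: "d \<in> D \<Longrightarrow> J d \<in> D"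
    and R4 [simp]: "d \<in> D \<Longrightarrow> R (R (R (R d))) = d" and J2 [simp]: "d \<in> D \<Longrightarrow> J (J d) = d"
    and face: "d \<in> D \<Longrightarrow> R (J (R (J (R (J (R (J d))))))) = d"
    and t_R [simp]: "d \<in> D \<Longrightarrow> t (R d) = t d"
    and same_tail: "d \<in> D \<Longrightarrow> e \<in> D \<Longrightarrow> t d = t e \<Longrightarrow> e \<in> {d, R d, R (R d), R (R (R d))}"
    and tails: "t ` D = V"
    and edge: "{u, v} \<in> E \<longleftrightarrow> (\<exists>d\<in>D. u = t d \<and> (v = t (J d) \<or> v = t (J (R (J d)))))"
begin

text \<open>\<open>F\<close> moves a dart one step ahead and \<open>L\<close> one step to the left, without turning it.\<close>

definition F :: "'d \<Rightarrow> 'd" where "F d = R (R (J d))"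
definition Fi :: "'d \<Rightarrow> 'd" where "Fi d = J (R (R d))"
definition L :: "'d \<Rightarrow> 'd" where "L d = R (J (R d))"
definition Li :: "'d \<Rightarrow> 'd" where "Li d = R (R (R (J (R (R (R d))))))"

lemma moves_in [simp]: "d \<in> D \<Longrightarrow> F d \<in> D" "d \<in> D \<Longrightarrow> Fi d \<in> D" "d \<in> D \<Longrightarrow> L d \<in> D" "d \<in> D \<Longrightarrow> Li d \<in> D"
  by (simp_all add: F_def Fi_def L_def Li_def)

lemma moves_inverse [simp]:
  "d \<in> D \<Longrightarrow> F (Fi d) = d" "d \<in> D \<Longrightarrow> Fi (F d) = d" "d \<in> D \<Longrightarrow> L (Li d) = d" "d \<in> D \<Longrightarrow> Li (L d) = d"
  by (simp_all add: F_def Fi_def L_def Li_def)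

text \<open>The face relation, that the fourth power of \<open>R o J\<close> is the identity, solved
  for \<open>J R J\<close>; \<open>R R R\<close> stands for the inverse of \<open>R\<close>.\<close>

lemma JRJ: "d \<in> D \<Longrightarrow> J (R (J d)) = R (R (R (J (R (R (R (J (R (R (R d))))))))))"
  using face[of "R (R (R (J (R (R (R (J (R (R (R d))))))))))"] face[of d]
  by (metis R4 R_in J2 J_in)

text \<open>The two sides are the two ways around a face to its opposite corner. They agree because
  faces are quadrangles, and this makes the steps an action of a rank 2 abelian group.\<close>

lemma LF: "d \<in> D \<Longrightarrow> L (F d) = F (L d)"
  using JRJ[of "R d"] by (simp add: F_def L_def)

lemma LFi: "d \<in> D \<Longrightarrow> L (Fi d) = Fi (L d)"
  using LF[of "Fi d"] by (metis moves_in(2,3) moves_inverse(1,2))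

text \<open>After a quarter turn, ahead is what used to be left, and left is what used to be
  backwards.\<close>

lemma FR: "d \<in> D \<Longrightarrow> F (R d) = R (L d)" and LR: "d \<in> D \<Longrightarrow> L (R d) = R (Fi d)"
  by (simp_all add: F_def L_def Fi_def)

text \<open>The action generated by the commuting steps \<open>F\<close> and \<open>L\<close>:
  \<open>dev d z\<close> is the dart parallel to \<open>d\<close> at the grid point \<open>z\<close>
  of the frame of \<open>d\<close>.\<close>

definition dev :: "'d \<Rightarrow> int \<times> int \<Rightarrow> 'd" where
  "dev d z = ipow F Fi (fst z) (ipow L Li (snd z) d)"

lemma dev_in [simp]: "d \<in> D \<Longrightarrow> dev d z \<in> D"
  by (simp add: dev_def ipow_in)

lemma F_dev: "d \<in> D \<Longrightarrow> F (dev d (a, b)) = dev d (a + 1, b)"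
  unfolding dev_def by (simp add: ipow_step[where D = D] ipow_in)

lemma L_dev:
  assumes "d \<in> D"
  shows "L (dev d (a, b)) = dev d (a, b + 1)"
proof -
  have "L (ipow F Fi a (ipow L Li b d)) = ipow F Fi a (L (ipow L Li b d))"
    by (rule ipow_commute[where D = D]) (use assms in \<open>simp_all add: ipow_in LF LFi\<close>)
  also have "L (ipow L Li b d) = ipow L Li (b + 1) d"
    by (rule ipow_step[where D = D]) (use assms in simp_all)
  finally show ?thesis by (simp add: dev_def)
qed

lemma dev_0: "dev d 0 = d"
  by (simp add: dev_def ipow_def)

text \<open>A map compatible with both unit steps is determined by its value at 0. This replaces
  separate inductions when the base dart is moved or turned.\<close>

lemma dev_unique:
  assumes "d \<in> D" "\<And>z. g z \<in> D" "g 0 = d"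
    and F: "\<And>a b. g (a + 1, b) = F (g (a, b))" and L: "\<And>a b. g (a, b + 1) = L (g (a, b))"
  shows "g z = dev d z"
proof -
  have "g (0, b) = dev d (0, b)" for b
  proof (induction b rule: int_induct[where k = 0])
    case base
    then show ?case using assms(3) dev_0 by (simp add: zero_prod_def)
  next
    case (step1 b)
    then show ?case using L L_dev[OF assms(1)] by metis
  next
    case (step2 b)
    then show ?case
      using L[of 0 "b - 1"] L_dev[OF assms(1), of 0 "b - 1"] assms(1,2) moves_inverse(4)
      by (metis dev_in diff_add_cancel)
  qed
  then have "g (a, b) = dev d (a, b)" for a b
  proof (induction a rule: int_induct[where k = 0])
    case (step1 a)
    then show ?case using F F_dev[OF assms(1)] by metis
  next
    case (step2 a)
    then show ?case
      using F[of "a - 1" b] F_dev[OF assms(1), of "a - 1" b] assms(1,2) moves_inverse(2)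
      by (metis dev_in diff_add_cancel)
  qed simp
  then show ?thesis by (cases z) simp
qed

lemma dev_add:
  assumes "d \<in> D"
  shows "dev d (z + y) = dev (dev d z) y"
proof (rule dev_unique)
  show "dev d (z + (a + 1, b)) = F (dev d (z + (a, b)))" for a b
    using assms F_dev[of d "fst z + a" "snd z + b"] by (cases z) (simp add: add.assoc)
  show "dev d (z + (a, b + 1)) = L (dev d (z + (a, b)))" for a b
    using assms L_dev[of d "fst z + a" "snd z + b"] by (cases z) (simp add: add.assoc)
qed (use assms in simp_all)

text \<open>The first axis in the frame of \<open>R d\<close> is the second axis of
  \<open>d\<close>, and its second axis is the reversed first axis of \<open>d\<close>.\<close>

lemma dev_R:
  assumes "d \<in> D"
  shows "dev (R d) (a, b) = R (dev d (- b, a))"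
proof -
  have "(\<lambda>(a, b). R (dev d (- b, a))) (a, b) = dev (R d) (a, b)"
  proof (rule dev_unique)
    show "(case (a + 1, b) of (a, b) \<Rightarrow> R (dev d (- b, a))) = F (case (a, b) of (a, b) \<Rightarrow> R (dev d (- b, a)))" for a b
      using assms by (simp add: L_dev[symmetric] FR)
    show "(case (a, b + 1) of (a, b) \<Rightarrow> R (dev d (- b, a))) = L (case (a, b) of (a, b) \<Rightarrow> R (dev d (- b, a)))" for a b
    proof -
      have "F (dev d (- b - 1, a)) = dev d (- b, a)" using F_dev[OF assms, of "- b - 1" a] by simp
      then have "dev d (- b - 1, a) = Fi (dev d (- b, a))" using assms by (metis dev_in moves_inverse(2))
      then show ?thesis using assms by (simp add: LR)
    qed
  qed (use assms dev_0 in \<open>auto simp: zero_prod_def split: prod.splits\<close>)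
  then show ?thesis by simp
qed

definition p :: "'d \<Rightarrow> int \<times> int \<Rightarrow> 'a" where
  "p d z = t (dev d z)"

lemma p_R: "d \<in> D \<Longrightarrow> p (R d) (a, b) = p d (- b, a)"
  by (simp add: p_def dev_R)

lemma p_add: "d \<in> D \<Longrightarrow> p d (z + y) = p (dev d z) y"
  by (simp add: p_def dev_add)

lemma t_J: "d \<in> D \<Longrightarrow> t (J d) = p d (1, 0)"
  using F_dev[of d 0 0] dev_0[of d] by (simp add: p_def F_def zero_prod_def flip: F_dev)
    (metis J_in R_in t_R)

text \<open>\<open>R\<close> turns counterclockwise in the frame of \<open>d\<close>, so reversing,
  turning and reversing leads around the face to the right of \<open>d\<close>; hence the sign of
  the second coordinate.\<close>

lemma t_JRJ:
  assumes "d \<in> D"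
  shows "t (J (R (J d))) = p d (1, -1)"
proof -
  have "L (dev d (0, -1)) = d" using L_dev[OF assms, of 0 "-1"] dev_0[of d] by (simp add: zero_prod_def)
  then have "dev d (0, -1) = Li d" using assms by (metis dev_in moves_inverse(4))
  then have "dev d (1, -1) = F (Li d)" using F_dev[OF assms, of 0 "-1"] by simp
  also have "\<dots> = R (R (R (J (R (J d)))))"
    using assms by (simp add: JRJ F_def Li_def)
  finally show ?thesis using assms by (simp add: p_def)
qed

lemma box_minus_0: "box - {0} = {(1,0), (0,1), (-1,0), (0,-1), (1,-1), (1,1), (-1,1), (-1,-1)}"
proof -
  have "{-1..1} = {-1, 0, 1 :: int}" by auto
  then show ?thesis by (auto simp: box_def zero_prod_def)
qed

lemma edge_at:
  assumes "e \<in> D"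
  shows "{t e, v} \<in> E \<longleftrightarrow> (\<exists>w\<in>box. w \<noteq> 0 \<and> v = p e w)"
proof -
  have "{t e, v} \<in> E \<longleftrightarrow> (\<exists>d\<in>{e, R e, R (R e), R (R (R e))}. v = t (J d) \<or> v = t (J (R (J d))))"
  proof -
    have "{d \<in> D. t e = t d} = {e, R e, R (R e), R (R (R e))}"
      using same_tail[OF assms] assms by auto
    moreover have "{t e, v} \<in> E \<longleftrightarrow> (\<exists>d\<in>{d \<in> D. t e = t d}. v = t (J d) \<or> v = t (J (R (J d))))"
      unfolding edge by blast
    ultimately show ?thesis by simp
  qed
  also have "\<dots> \<longleftrightarrow> v \<in> p e ` (box - {0})"
  proof -
    have "t (J e) = p e (1, 0)" "t (J (R e)) = p e (0, 1)"
      "t (J (R (R e))) = p e (-1, 0)" "t (J (R (R (R e)))) = p e (0, -1)"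
      using t_J[of e] t_J[of "R e"] t_J[of "R (R e)"] t_J[of "R (R (R e))"] assms
      by (simp_all add: p_R)
    moreover have "t (J (R (J e))) = p e (1, -1)" "t (J (R (J (R e)))) = p e (1, 1)"
      "t (J (R (J (R (R e))))) = p e (-1, 1)" "t (J (R (J (R (R (R e)))))) = p e (-1, -1)"
      using t_JRJ[of e] t_JRJ[of "R e"] t_JRJ[of "R (R e)"] t_JRJ[of "R (R (R e))"] assms
      by (simp_all add: p_R)
    ultimately show ?thesis unfolding box_minus_0 by auto
  qed
  finally show ?thesis by blast
qed

text \<open>The eight nonzero king's moves are mapped onto the edges at \<open>t e\<close>. There
  are exactly eight such edges by regularity, so the moves reach distinct vertices; none returns to
  \<open>t e\<close> because the graph has no loops.\<close>

lemma inj_on_p_box: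
  assumes "e \<in> D"
  shows "inj_on (p e) box"
proof -
  let ?B = "box - {0}"
  have mem: "t e \<in> x \<longleftrightarrow> (\<exists>v. x = {t e, v})" if "x \<in> E" for x
  proof -
    have "card x = 2" using graph that by (simp add: simple_graph_def)
    then show ?thesis by (auto simp: card_2_iff)
  qed
  have "{x \<in> E. t e \<in> x} = (\<lambda>w. {t e, p e w}) ` ?B"
  proof (intro set_eqI iffI)
    fix x assume "x \<in> {x \<in> E. t e \<in> x}"
    then obtain v where v: "x = {t e, v}" "{t e, v} \<in> E" using mem by auto
    then show "x \<in> (\<lambda>w. {t e, p e w}) ` ?B" using edge_at[OF assms, of v] by auto
  next
    fix x assume "x \<in> (\<lambda>w. {t e, p e w}) ` ?B"
    then obtain w where w: "w \<in> box" "w \<noteq> 0" "x = {t e, p e w}" by blast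
    then show "x \<in> {x \<in> E. t e \<in> x}" using edge_at[OF assms, of "p e w"] by blast
  qed
  moreover have "card {x \<in> E. t e \<in> x} = 8"
    using reg tails assms by (auto simp: regular_def degree_def)
  moreover have "card ?B = 8" "finite ?B" by (simp_all add: box_minus_0)
  ultimately have inj: "inj_on (\<lambda>w. {t e, p e w}) ?B" by (intro eq_card_imp_inj_on) simp_all
  have "inj_on (p e) ?B"
  proof (rule inj_onI)
    fix w w' assume "w \<in> ?B" "w' \<in> ?B" "p e w = p e w'"
    then show "w = w'" using inj_onD[OF inj, of w w'] by simp
  qed
  moreover have "p e 0 \<notin> p e ` ?B"
  proof
    assume "p e 0 \<in> p e ` ?B"
    then have "{t e, p e 0} \<in> E" using edge_at[OF assms, of "p e 0"] by auto
    then have "{t e} \<in> E" by (simp add: p_def dev_0)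
    then have "card {t e} = 2" using graph unfolding simple_graph_def by blast
    then show False by simp
  qed
  moreover have "box = insert 0 ?B" by (auto simp: box_def zero_prod_def)
  ultimately show ?thesis by (metis inj_on_insert Diff_idemp)
qed

text \<open>A vector of this square is a difference \<open>u - u'\<close> of two vectors of
  \<open>box\<close>, obtained by halving its coordinates. So \<open>z\<close> and
  \<open>z + w\<close> both lie in the box around \<open>z - u'\<close>, where \<open>p d\<close> is
  injective.\<close>

lemma small:
  assumes d: "d \<in> D" and w: "w \<in> {-2..2} \<times> {-2..2}" and eq: "p d (z + w) = p d z"
  shows "w = 0"
proof -
  obtain a b where ab: "w = (a, b)" "a \<in> {-2..2}" "b \<in> {-2..2}" using w by auto
  define u where "u = (a - a div 2, b - b div 2)"
  define u' where "u' = (- (a div 2), - (b div 2))"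
  have u: "u \<in> box" "u' \<in> box" using ab(2,3) by (auto simp: u_def u'_def box_def)
  have "z + w = (z - u') + u" "z = (z - u') + u'"
    by (simp_all add: ab u_def u'_def prod_eq_iff)
  then have "p (dev d (z - u')) u = p (dev d (z - u')) u'"
    using eq p_add[OF d] by metis
  then have "u = u'" using inj_on_p_box[OF dev_in[OF d]] u by (meson inj_onD)
  then show ?thesis by (simp add: ab u_def u'_def zero_prod_def)
qed

text \<open>Such a return would identify grid points along a quarter turn of the plane. If its
  centre is a face centre, two adjacent corners of that face coincide; if it is a grid point, two of
  its neighbours coincide.\<close>

lemma no_quarter_turn:
  assumes e: "e \<in> D" shows "dev e y \<noteq> R e"
proof
  assume eq: "dev e y = R e"
  obtain s u where y: "y = (s, u)" by fastforce
  \<comment> \<open>The centre of the rotation is the grid point \<open>(- b, u + b)\<close> or at distance \<open>1/\<surd>2\<close> from it.\<close>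
  define b where "b = - ((s + u) div 2)"
  have turn: "dev e (y + (u + b, b)) = R (dev e (- b, u + b))"
    using e by (simp add: dev_add eq dev_R)
  have "s + (u + b) = - b + (s + u) mod 2"
    using div_mult_mod_eq[of "s + u" 2] unfolding b_def by linarith
  then have sum: "y + (u + b, b) = (- b, u + b) + ((s + u) mod 2, 0)"
    by (simp add: y algebra_simps)
  have "p e ((- b, u + b) + ((s + u) mod 2, 0)) = p e (- b, u + b)"
    using turn e unfolding p_def sum by simp
  then have "((s + u) mod 2, 0) = (0 :: int \<times> int)"
    by (rule small[OF e, rotated]) (auto intro: order_trans[of _ 0])
  then have fixed: "dev e (- b, u + b) = R (dev e (- b, u + b))"
    using turn unfolding sum by simp
  let ?e = "dev e (- b, u + b)"
  have "p ?e (1, 0) = p ?e (0, 1)" using p_R[of ?e 1 0] fixed e by simp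
  then have "(1, 0) = (0 :: int, 1 :: int)"
    by (rule inj_onD[OF inj_on_p_box[OF dev_in[OF e]]]) (simp_all add: box_def)
  then show False by simp
qed

lemma no_half_turn:
  assumes e: "e \<in> D" shows "dev e y \<noteq> R (R e)"
proof
  assume eq: "dev e y = R (R e)"
  obtain s u where y: "y = (s, u)" by fastforce
  \<comment> \<open>The half turn has centre \<open>y / 2\<close>. It sends \<open>(a, b)\<close>,
    that centre rounded down, to \<open>(a, b) + (s mod 2, u mod 2)\<close>, which is too close to
    be another preimage of the same vertex.\<close>
  define a where "a = s div 2"
  define b where "b = u div 2"
  have turn: "dev e (y + (- a, - b)) = R (R (dev e (a, b)))"
    using e by (simp add: dev_add eq dev_R)
  have "s - a = a + s mod 2" "u - b = b + u mod 2"
    using div_mult_mod_eq[of s 2] div_mult_mod_eq[of u 2] unfolding a_def b_def by linarith+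
  then have sum: "y + (- a, - b) = (a, b) + (s mod 2, u mod 2)"
    by (simp add: y)
  have "p e ((a, b) + (s mod 2, u mod 2)) = p e (a, b)"
    using turn e unfolding p_def sum by simp
  then have "(s mod 2, u mod 2) = (0 :: int \<times> int)"
    by (rule small[OF e, rotated]) (auto intro: order_trans[of _ 0])
  then have fixed: "dev e (a, b) = R (R (dev e (a, b)))"
    using turn unfolding sum by simp
  let ?e = "dev e (a, b)"
  have "p ?e (1, 0) = p ?e (-1, 0)" using p_R[of ?e 0 1] p_R[of "R ?e" 1 0] fixed e by simp
  then have "(1, 0) = (-1 :: int, 0 :: int)"
    by (rule inj_onD[OF inj_on_p_box[OF dev_in[OF e]]]) (simp_all add: box_def)
  then show False by simp
qed

lemma no_rotation:
  assumes e: "e \<in> D" and t: "t (dev e y) = t e"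
  shows "dev e y = e"
proof -
  let ?f = "dev e y"
  \<comment> \<open>The remaining case, three quarter turns, is a single quarter turn when read
    backwards from \<open>?f\<close>.\<close>
  have "dev ?f (- y) = e" using dev_add[OF e, of y "- y"] dev_0 by simp
  moreover have "R ?f = e" if "?f = R (R (R e))" using that e by simp
  moreover have "?f \<in> {e, R e, R (R e), R (R (R e))}"
    using same_tail[OF e dev_in[OF e]] t by metis
  ultimately show ?thesis
    using no_quarter_turn[OF e, of y] no_half_turn[OF e, of y] no_quarter_turn[of ?f "- y"] e
    by auto
qed

text \<open>Without rotations, grid points over the same vertex carry the same dart, so the
  development continues identically from both. All identifications are therefore
  translations.\<close>

lemma p_eqD:
  assumes d: "d \<in> D" and "p d z = p d y"
  shows "dev d z = dev d y"
proof -
  have "dev (dev d y) (z - y) = dev d z" using dev_add[OF d, of y "z - y"] by simp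
  then show ?thesis using no_rotation[of "dev d y" "z - y"] assms by (simp add: p_def)
qed

lemma range_p:
  assumes d: "d \<in> D"
  shows "range (p d) = V"
proof
  show "range (p d) \<subseteq> V" using tails d by (auto simp: p_def)
  show "V \<subseteq> range (p d)"
  proof
    fix v assume "v \<in> V"
    then have "(t d, v) \<in> {(x, y). x \<in> V \<and> y \<in> V \<and> {x, y} \<in> E}\<^sup>*"
      using conn tails d unfolding connected_on_def by blast
    then show "v \<in> range (p d)"
    proof (induction rule: rtrancl_induct)
      case base
      then show ?case using dev_0[of d] by (metis p_def rangeI)
    next
      case (step x y)
      then obtain z where "x = t (dev d z)" by (auto simp: p_def)
      then obtain w where "y = p (dev d z) w" using step(2) edge_at[OF dev_in[OF d]] by auto
      then show ?case using p_add[OF d] by (metis rangeI)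
    qed
  qed
qed

lemma king_torus_p:
  assumes d: "d \<in> D"
  shows "king_torus V E (p d)"
proof
  show "p d (x + z) = p d (y + z)" if "p d x = p d y" for x y z
    using p_eqD[OF d that] by (simp add: p_add[OF d])
  show "{p d z, v} \<in> E \<longleftrightarrow> (\<exists>w\<in>box. w \<noteq> 0 \<and> v = p d (z + w))" for z v
    using edge_at[OF dev_in[OF d]] by (simp add: p_add[OF d]) (simp add: p_def)
qed (use graph range_p[OF d] small[OF d] in auto)

text \<open>Restates a period as a property of one dart under the operations of the map, a form that
  can be carried along an isomorphism.\<close>

lemma F3_iff: "d \<in> D \<Longrightarrow> p d (3, 0) = p d 0 \<longleftrightarrow> F (F (F d)) = d"
  using p_eqD[of d "(3, 0)" 0] F_dev[of d 0 0] F_dev[of d 1 0] F_dev[of d 2 0] dev_0[of d]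
  by (auto simp: p_def zero_prod_def)

lemma L3_iff: "d \<in> D \<Longrightarrow> p d (0, 3) = p d 0 \<longleftrightarrow> L (L (L d)) = d"
  using p_eqD[of d "(0, 3)" 0] L_dev[of d 0 0] L_dev[of d 0 1] L_dev[of d 0 2] dev_0[of d]
  by (auto simp: p_def zero_prod_def)

lemma F3_R: "d \<in> D \<Longrightarrow> F (F (F (R d))) = R (L (L (L d)))"
  by (simp add: FR)

end

section \<open>The maps Q(p,r,3)\<close>

lemma (in king_torus) period_mult: "p u = p 0 \<Longrightarrow> p (k * fst u, k * snd u) = p 0"
proof (induction k rule: int_induct[where k = 0])
  case (step1 k)
  then show ?case
    using shift[of "(k * fst u, k * snd u)" 0 u] by (cases u) (simp add: algebra_simps)
next
  case (step2 k)
  then show ?case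
    using p_eq_iff[of "(k * fst u, k * snd u)" u] by (cases u) (simp add: algebra_simps)
qed (simp add: zero_prod_def)

text \<open>A normal form for the lattice of periods: \<open>a\<close> is the least positive first
  coordinate of a period, which exists because \<open>V\<close> is finite, and \<open>r\<close> is
  the second coordinate of such a period reduced modulo 3. Every vertex has a preimage among
  \<open>a\<close> columns of height 3, so ten vertices force \<open>4 <= a\<close>.\<close>

lemma (in king_torus) lattice_basis:
  assumes per: "p (0, 3) = p 0" and V: "10 \<le> card V"
  obtains a r where "4 \<le> a" "0 \<le> r"
    "\<And>x y. p (x, y) = p 0 \<longleftrightarrow> (\<exists>i j. x = i * a \<and> y = i * r + j * 3)"
proof -
  let ?Q = "\<lambda>n. 0 < n \<and> (\<exists>b. p (int n, b) = p 0)"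
  have "\<not> inj (\<lambda>n. p (int n, 0))"
    using finite_imageD[of "\<lambda>n. p (int n, 0)" UNIV] finite_subset[OF _ finite_V] range_p
    by (metis (no_types, lifting) image_subsetI infinite_UNIV_nat rangeI)
  then obtain m n where mn: "m < n" "p (int m, 0) = p (int n, 0)"
    unfolding inj_def by (metis linorder_neqE_nat)
  then have "?Q (n - m)"
    using p_eq_iff[of "(int n, 0)" "(int m, 0)"] by (auto simp: of_nat_diff)
  define c where "c = (LEAST n. ?Q n)"
  have c: "?Q c" unfolding c_def using \<open>?Q (n - m)\<close> by (rule LeastI)
  have c_min: "c \<le> k" if "?Q k" for k unfolding c_def using that by (rule Least_le)
  obtain b where b: "p (int c, b) = p 0" using c by blast
  define a where "a = int c"
  define r where "r = b mod 3"
  have a: "0 < a" using c by (simp add: a_def)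
  have three: "p (0, 3 * j) = p 0" for j using period_mult[OF per, of j] by (simp add: mult.commute)
  have ar: "p (a, r) = p 0"
  proof -
    have "(a, b) - (0, 3 * (b div 3)) = (a, r)" by (simp add: r_def minus_mult_div_eq_mod)
    then show ?thesis
      using b p_eq_iff[of "(a, b)" "(0, 3 * (b div 3))"] three[of "b div 3"] unfolding a_def by metis
  qed
  have lat: "p (i * a, i * r + j * 3) = p 0" for i j
    using shift[OF period_mult[OF ar, of i], of "(0, 3 * j)"] three[of j]
    by (simp add: mult.commute)
  have reduce: "p (x, y) = p (x mod a, (y - x div a * r) mod 3)" for x y
  proof -
    let ?j = "(y - x div a * r) div 3"
    have "(x, y) = (x div a * a, x div a * r + ?j * 3) + (x mod a, (y - x div a * r) mod 3)"
      by (simp add: algebra_simps minus_mod_eq_mult_div[symmetric])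
    then show ?thesis
      using shift[OF lat[of "x div a" ?j], of "(x mod a, (y - x div a * r) mod 3)"] by simp
  qed
  have m3: "k mod 3 \<in> {0, 1, 2}" for k :: int by auto
  have iff: "p (x, y) = p 0 \<longleftrightarrow> (\<exists>i j. x = i * a \<and> y = i * r + j * 3)" for x y
  proof
    assume "p (x, y) = p 0"
    then have eq: "p (x mod a, (y - x div a * r) mod 3) = p 0" using reduce by simp
    have "x mod a = 0"
    proof (rule ccontr)
      assume "x mod a \<noteq> 0"
      then have "0 < x mod a" using a by (simp add: order_less_le)
      then have "?Q (nat (x mod a))" using eq by auto
      then have "c \<le> nat (x mod a)" by (rule c_min)
      then show False using pos_mod_bound[OF a, of x] a_def \<open>0 < x mod a\<close> by linarith
    qed
    \<comment> \<open>What remains is a vertical period of length at most 2, which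
      \<open>small\<close> allows only if it is 0.\<close>
    moreover have "(0, (y - x div a * r) mod 3) = (0 :: int \<times> int)"
      using eq m3[of "y - x div a * r"] \<open>x mod a = 0\<close> by (intro small[of _ 0]) auto
    ultimately have "x = x div a * a" "y = x div a * r + (y - x div a * r) div 3 * 3"
      by (auto simp: zero_prod_def)
    then show "\<exists>i j. x = i * a \<and> y = i * r + j * 3" by blast
  next
    assume "\<exists>i j. x = i * a \<and> y = i * r + j * 3"
    then show "p (x, y) = p 0" using lat by blast
  qed
  have "V \<subseteq> p ` ({0..<a} \<times> {0..<3})"
  proof
    fix v assume "v \<in> V"
    then obtain x y where "v = p (x, y)" using range_p by auto
    then have "v = p (x mod a, (y - x div a * r) mod 3)" using reduce by simp
    moreover have "(x mod a, (y - x div a * r) mod 3) \<in> {0..<a} \<times> {0..<3}" using a by simp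
    ultimately show "v \<in> p ` ({0..<a} \<times> {0..<3})" by blast
  qed
  then have "card V \<le> card (p ` ({0..<a} \<times> {0..<3}))" by (intro card_mono) auto
  also have "\<dots> \<le> card ({0..<a} \<times> {0..<3 :: int})" by (rule card_image_le) simp
  finally have "10 \<le> nat a * 3" using V by simp
  then have "4 \<le> a" by linarith
  moreover have "0 \<le> r" by (simp add: r_def)
  ultimately show ?thesis using iff that by blast
qed

context square_map
begin

lemma R_distinct:
  assumes "e \<in> D"
  shows "R e \<noteq> e" "R (R e) \<noteq> e" "R (R (R e)) \<noteq> e"
proof -
  show *: "R e \<noteq> e" using no_quarter_turn[OF assms, of 0] by (simp add: dev_0)
  show "R (R e) \<noteq> e" using no_half_turn[OF assms, of 0] by (simp add: dev_0)
  show "R (R (R e)) \<noteq> e" using * R4[OF assms] by metis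
qed

text \<open>Quantifying over all darts covers both axes: a quarter turn changes a dart fixed by
  three \<open>L\<close> steps into one fixed by three \<open>F\<close> steps.\<close>

lemma connectivity:
  "vertex_connectivity V E \<in> {6, 8} \<and>
    (k_connected V E 8 \<longleftrightarrow> \<not> (10 \<le> card V \<and> (\<exists>d\<in>D. F (F (F d)) = d)))"
proof -
  have cut: "\<not> k_connected V E k" if "10 \<le> card V" "d \<in> D" "F (F (F d)) = d" "7 \<le> k" for d k
    using king_torus.not_k_connected_7[OF king_torus_p[OF that(2)]] F3_iff[OF that(2)] that by blast
  obtain d where d: "d \<in> D" using conn tails unfolding connected_on_def by blast
  interpret king_torus V E "p d" by (rule king_torus_p[OF d])
  show ?thesis
  proof (cases "k_connected V E 8")
    case True
    have "Max {k. k_connected V E k} = 8"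
    proof (rule Max_eqI)
      have le: "k \<le> 8" if "k_connected V E k" for k
        using not_k_connected_9[of k] that by (cases "k \<le> 8") auto
      show "finite {k. k_connected V E k}"
      proof (rule finite_subset)
        show "{k. k_connected V E k} \<subseteq> {..8}" using le by blast
      qed simp
      show "k \<le> 8" if "k \<in> {k. k_connected V E k}" for k using le that by blast
    qed (use True in simp)
    then show ?thesis using True cut by (auto simp: vertex_connectivity_def)
  next
    case False
    then have 6: "k_connected V E 6" "10 \<le> card V" "p d (3, 0) = p d 0 \<or> p d (0, 3) = p d 0"
      using k_connected_8_or_6 by auto
    have ex: "\<exists>d\<in>D. F (F (F d)) = d"
      using 6(3) F3_iff[OF d] L3_iff[OF d] F3_R[OF d] d R_in by metis
    then obtain e where e: "e \<in> D" "F (F (F e)) = e" by blast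
    have "Max {k. k_connected V E k} = 6"
    proof (rule Max_eqI)
      have le: "k \<le> 6" if "k_connected V E k" for k
        using cut[OF 6(2) e, of k] that by force
      show "finite {k. k_connected V E k}"
      proof (rule finite_subset)
        show "{k. k_connected V E k} \<subseteq> {..6}" using le by blast
      qed simp
      show "k \<le> 6" if "k \<in> {k. k_connected V E k}" for k using le that by blast
    qed (use 6 in simp)
    then show ?thesis using False 6(2) ex by (auto simp: vertex_connectivity_def)
  qed
qed

text \<open>At most four darts share a tail. The bound turns a count of darts, which an isomorphism
  preserves, into a lower bound on \<open>card V\<close>.\<close>

lemma finite_D: "finite D" and card_D_le: "card D \<le> 4 * card V"
proof -
  define s where "s v = (SOME d. d \<in> D \<and> t d = v)" for v
  have s: "s v \<in> D \<and> t (s v) = v" if "v \<in> V" for v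
  proof -
    have "\<exists>d. d \<in> D \<and> t d = v" using that tails by blast
    then show ?thesis unfolding s_def by (rule someI_ex)
  qed
  have D: "D \<subseteq> (\<Union>v\<in>V. {s v, R (s v), R (R (s v)), R (R (R (s v)))})"
  proof
    fix d assume d: "d \<in> D"
    then have v: "t d \<in> V" using tails by blast
    then have "d \<in> {s (t d), R (s (t d)), R (R (s (t d))), R (R (R (s (t d))))}"
      using same_tail[of "s (t d)" d] s[OF v] d by simp
    then show "d \<in> (\<Union>v\<in>V. {s v, R (s v), R (R (s v)), R (R (R (s v)))})" using v by blast
  qed
  have V: "finite V" using graph by (simp add: simple_graph_def)
  then show "finite D" using D finite_subset by fastforce
  have "card D \<le> card (\<Union>v\<in>V. {s v, R (s v), R (R (s v)), R (R (R (s v)))})"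
    using D V by (intro card_mono) auto
  also have "\<dots> \<le> (\<Sum>v\<in>V. card {s v, R (s v), R (R (s v)), R (R (R (s v)))})"
    by (rule card_UN_le[OF V])
  also have "\<dots> \<le> (\<Sum>v\<in>V. 4)"
    by (intro sum_mono) (simp add: card_insert_if)
  finally show "card D \<le> 4 * card V" by simp
qed

end

section \<open>Darts of the grid and of its quotients\<close>

definition dirs :: "(int \<times> int) set" where
  "dirs = {(1, 0), (0, 1), (-1, 0), (0, -1)}"

lemma grid_simps [simp]:
  "darts grid_map = UNIV \<times> dirs"
  "opp grid_map ((a, b), (s, u)) = ((a + s, b + u), (- s, - u))"
  "nxt grid_map ((a, b), (s, u)) = ((a, b), (- u, s))"
  by (simp_all add: grid_map_def dirs_def)

lemma torus_simps [simp]: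
  "darts (torus_quad a r q) = darts grid_map // lattice_rel a r q"
  "opp (torus_quad a r q) C = opp grid_map ` C"
  "nxt (torus_quad a r q) C = nxt grid_map ` C"
  by (simp_all add: torus_quad_def)

lemma lattice_rel_iff:
  "(((x, y), w), ((x', y'), w')) \<in> lattice_rel a r q \<longleftrightarrow>
     w \<in> dirs \<and> w' = w \<and> (\<exists>i j. x' = x + i * a \<and> y' = y + i * r + j * q)"
  by (auto simp: lattice_rel_def dirs_def)

text \<open>Four columns of three grid points with four directions each give distinct classes, since
  a nonzero multiple of \<open>a\<close> shifts by at least four columns. With at most four darts
  per vertex this means at least 12 vertices.\<close>

lemma card_torus_quad:
  assumes "4 \<le> a" "finite (darts (torus_quad a r 3))"
  shows "48 \<le> card (darts (torus_quad a r 3))"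
proof -
  let ?A = "({0..<4 :: int} \<times> {0..<3 :: int}) \<times> dirs"
  let ?c = "\<lambda>x. lattice_rel a r 3 `` {x}"
  have "inj_on ?c ?A"
  proof (rule inj_onI)
    fix x y assume x: "x \<in> ?A" and y: "y \<in> ?A" and eq: "?c x = ?c y"
    obtain x1 x2 w y1 y2 w' where xy: "x = ((x1, x2), w)" "y = ((y1, y2), w')"
      by (metis surj_pair)
    have "y \<in> ?c y" using y unfolding xy by (auto simp: lattice_rel_iff intro: exI[of _ 0])
    then have "(x, y) \<in> lattice_rel a r 3" using eq by blast
    then obtain i j where ij: "y1 = x1 + i * a" "y2 = x2 + i * r + j * 3" "w' = w"
      unfolding xy lattice_rel_iff by blast
    have "i = 0"
    proof (rule ccontr)
      assume "i \<noteq> 0"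
      then have "\<bar>a\<bar> * 1 \<le> \<bar>a\<bar> * \<bar>i\<bar>" by (intro mult_left_mono) auto
      then have "4 \<le> \<bar>a\<bar> * \<bar>i\<bar>" using assms(1) by linarith
      then have "4 \<le> \<bar>i * a\<bar>" by (simp add: abs_mult mult.commute)
      then show False using ij(1) x y xy by auto
    qed
    then have "j = 0" using ij(2) x y xy by auto
    then show "x = y" using ij \<open>i = 0\<close> xy by simp
  qed
  then have "card (?c ` ?A) = card ?A" by (rule card_image)
  also have "\<dots> = 48" by (simp add: card_cartesian_product dirs_def)
  finally have "card (?c ` ?A) = 48" .
  moreover have "?c ` ?A \<subseteq> darts (torus_quad a r 3)"
    by (auto simp: intro!: quotientI)
  ultimately show ?thesis using card_mono[OF assms(2)] by metis
qed

context square_map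
begin

lemma iso_imp:
  assumes M: "darts M = D" "opp M = J" "nxt M = R"
    and iso: "map_iso M (torus_quad a r 3)" and a: "4 \<le> a"
  shows "10 \<le> card V \<and> (\<exists>d\<in>D. F (F (F d)) = d)"
proof -
  let ?N = "torus_quad a r 3"
  obtain h where h: "bij_betw h D (darts ?N)" "\<And>d. d \<in> D \<Longrightarrow> h (J d) = opp ?N (h d)"
    and or: "(\<forall>d\<in>D. h (R d) = nxt ?N (h d)) \<or> (\<forall>d\<in>D. nxt ?N (h (R d)) = h d)"
    using iso unfolding map_iso_def M by blast
  \<comment> \<open>A half turn is its own inverse, so this holds whether \<open>h\<close> preserves
    or reverses the orientation. \<open>F\<close> involves only \<open>J\<close> and a half turn and
    is therefore transported in both cases.\<close>
  have RR: "h (R (R d)) = nxt ?N (nxt ?N (h d))" if "d \<in> D" for d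
    using or that R4[OF that] R_in by metis
  let ?T = "\<lambda>C. nxt ?N (nxt ?N (opp ?N C))"
  have F: "h (F d) = ?T (h d)" if "d \<in> D" for d
    unfolding F_def using RR[of "J d"] h(2)[OF that] that by simp
  let ?C = "lattice_rel a r 3 `` {((0, 0), (0, 1))}"
  have C: "?C = {((i * a, i * r + j * 3), (0, 1)) | i j. True}"
    by (auto simp: lattice_rel_def) blast+
  define g where "g x = nxt grid_map (nxt grid_map (opp grid_map (nxt grid_map (nxt grid_map
    (opp grid_map (nxt grid_map (nxt grid_map (opp grid_map x))))))))" for x
  have g: "g ((x, y), (0, 1)) = ((x, y + 3), (0, 1))" for x y
    by (simp add: g_def)
  have "?C \<in> darts ?N" by (auto simp: dirs_def intro!: quotientI)
  then obtain d where d: "d \<in> D" "h d = ?C" using h(1) unfolding bij_betw_def by (metis imageE)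
  have "h (F (F (F d))) = ?T (?T (?T ?C))" using F d by simp
  also have "\<dots> = g ` ?C"
    unfolding g_def by (simp only: torus_simps image_image)
  also have "\<dots> = ?C"
  proof (intro set_eqI iffI)
    fix x assume "x \<in> g ` ?C"
    then obtain i j where "x = g ((i * a, i * r + j * 3), (0, 1))" unfolding C by blast
    then have "x = ((i * a, i * r + (j + 1) * 3), (0, 1))" by (simp add: g)
    then show "x \<in> ?C" unfolding C by blast
  next
    fix x assume "x \<in> ?C"
    then obtain i j where "x = ((i * a, i * r + j * 3), (0, 1))" unfolding C by blast
    then have "x = g ((i * a, i * r + (j - 1) * 3), (0, 1))" by (simp add: g)
    then show "x \<in> g ` ?C" unfolding C by blast
  qed
  finally have "F (F (F d)) = d" using d h(1) unfolding bij_betw_def inj_on_def by auto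
  moreover have "10 \<le> card V"
    using card_torus_quad[OF a, of r] bij_betw_finite[OF h(1)] bij_betw_same_card[OF h(1)]
      finite_D card_D_le by auto
  ultimately show ?thesis using d by blast
qed

text \<open>The covering of the map by the grid, based at \<open>d\<close>: the direction determines
  how often the developed dart is turned. The last branch is meant for
  \<open>(0, -1)\<close>.\<close>

definition grid_dart :: "'d \<Rightarrow> grid_dart \<Rightarrow> 'd" where
  "grid_dart d x = (let e = dev d (fst x) in
     if snd x = (1, 0) then e else if snd x = (0, 1) then R e
     else if snd x = (-1, 0) then R (R e) else R (R (R e)))"

lemma grid_dart_simps:
  "grid_dart d (z, (1, 0)) = dev d z" "grid_dart d (z, (0, 1)) = R (dev d z)"
  "grid_dart d (z, (-1, 0)) = R (R (dev d z))" "grid_dart d (z, (0, -1)) = R (R (R (dev d z)))"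
  by (simp_all add: grid_dart_def)

lemma grid_dart_in: "d \<in> D \<Longrightarrow> grid_dart d x \<in> D"
  by (simp add: grid_dart_def Let_def)

lemma grid_dart_nxt:
  assumes "d \<in> D" "x \<in> darts grid_map"
  shows "grid_dart d (nxt grid_map x) = R (grid_dart d x)"
  using assms by (auto simp: dirs_def grid_dart_simps)

lemma grid_dart_opp:
  assumes "d \<in> D" "x \<in> darts grid_map"
  shows "grid_dart d (opp grid_map x) = J (grid_dart d x)"
proof -
  have F: "dev d (a - 1, b) = Fi (dev d (a, b))" for a b
    using F_dev[OF assms(1), of "a - 1" b] assms(1) by (metis dev_in diff_add_cancel moves_inverse(2))
  have L: "dev d (a, b - 1) = Li (dev d (a, b))" for a b
    using L_dev[OF assms(1), of a "b - 1"] assms(1) by (metis dev_in diff_add_cancel moves_inverse(4))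
  show ?thesis
    using assms
    by (auto simp: dirs_def grid_dart_simps F L F_dev[symmetric] L_dev[symmetric] F_def L_def Fi_def Li_def)
qed

lemma grid_dart_surj:
  assumes d: "d \<in> D" and e: "e \<in> D"
  shows "\<exists>x\<in>darts grid_map. grid_dart d x = e"
proof -
  have "t e \<in> range (p d)" using range_p[OF d] tails e by blast
  then obtain z where "t (dev d z) = t e" by (auto simp: p_def)
  then have "e \<in> grid_dart d ` ({z} \<times> dirs)"
    using same_tail[of "dev d z" e] d e by (auto simp: dirs_def grid_dart_simps)
  then show ?thesis by auto
qed

text \<open>Directions can be read off because the four turns of a dart are distinct, and the base
  points then differ by a period. So the fibres of the covering are exactly the classes that define
  the quotient.\<close>

lemma grid_dart_eq_iff:
  assumes d: "d \<in> D" and x: "x \<in> darts grid_map" "y \<in> darts grid_map"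
  shows "grid_dart d x = grid_dart d y \<longleftrightarrow> snd x = snd y \<and> p d (fst x) = p d (fst y)"
proof
  assume eq: "grid_dart d x = grid_dart d y"
  have t: "t (grid_dart d x) = p d (fst x)" for x
    using d by (simp add: grid_dart_def p_def Let_def)
  then have p: "p d (fst x) = p d (fst y)" using eq by metis
  then have "dev d (fst x) = dev d (fst y)" by (rule p_eqD[OF d])
  then show "snd x = snd y \<and> p d (fst x) = p d (fst y)"
    using eq p x R_distinct[OF dev_in[OF d, of "fst y"]] d
    by (auto simp: dirs_def grid_dart_simps) (metis R4 R_in dev_in)+
next
  assume "snd x = snd y \<and> p d (fst x) = p d (fst y)"
  then show "grid_dart d x = grid_dart d y"
    using p_eqD[OF d] by (metis grid_dart_def)
qed

lemma imp_iso:
  assumes M: "darts M = D" "opp M = J" "nxt M = R"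
    and V: "10 \<le> card V" and e: "e \<in> D" "F (F (F e)) = e"
  shows "\<exists>a r. 4 \<le> a \<and> 0 \<le> r \<and> map_iso M (torus_quad a r 3)"
proof -
  \<comment> \<open>The base dart is turned so that the given 3-cycle, which runs ahead of
    \<open>e\<close>, becomes vertical: the lattice of \<open>Q(p,r,3)\<close> contains
    \<open>(0, 3)\<close>.\<close>
  define d where "d = R (R (R e))"
  have d: "d \<in> D" "R d = e" using e by (simp_all add: d_def)
  then have "R (L (L (L d))) = R d" using F3_R[OF d(1)] e by simp
  then have "L (L (L d)) = d" using d(1) by (metis R4 moves_in(3))
  then have per: "p d (0, 3) = p d 0" using L3_iff[OF d(1)] by simp
  interpret king_torus V E "p d" by (rule king_torus_p[OF d(1)])
  obtain a r where ar: "4 \<le> a" "0 \<le> r"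
    "\<And>x y. p d (x, y) = p d 0 \<longleftrightarrow> (\<exists>i j. x = i * a \<and> y = i * r + j * 3)"
    using lattice_basis[OF per V] by blast
  let ?N = "torus_quad a r 3"
  let ?G = "darts grid_map"
  have rel: "(x, y) \<in> lattice_rel a r 3 \<longleftrightarrow> y \<in> ?G \<and> grid_dart d x = grid_dart d y" if x: "x \<in> ?G" for x y
  proof -
    obtain x1 x2 w y1 y2 w' where xy: "x = ((x1, x2), w)" "y = ((y1, y2), w')"
      by (metis surj_pair)
    have "p d (x1, x2) = p d (y1, y2) \<longleftrightarrow> p d (y1 - x1, y2 - x2) = p d 0"
      using p_eq_iff[of "(y1, y2)" "(x1, x2)"] by auto
    also have "\<dots> \<longleftrightarrow> (\<exists>i j. y1 = x1 + i * a \<and> y2 = x2 + i * r + j * 3)"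
      unfolding ar(3) by (simp add: algebra_simps)
    finally show ?thesis
      using x grid_dart_eq_iff[OF d(1), of x y] unfolding xy lattice_rel_iff by auto
  qed
  \<comment> \<open>A dart is sent to its whole fibre in the grid, which \<open>rel\<close>
    identifies as one class.\<close>
  define h where "h e = {x \<in> ?G. grid_dart d x = e}" for e
  have h_eq: "h (grid_dart d x) = lattice_rel a r 3 `` {x}" if "x \<in> ?G" for x
    using rel[OF that] by (auto simp: h_def)
  have "bij_betw h D (darts ?N)"
  proof (rule bij_betw_imageI)
    show "inj_on h D"
      using grid_dart_surj[OF d(1)] by (intro inj_onI) (auto simp: h_def)
    show "h ` D = darts ?N"
    proof
      show "h ` D \<subseteq> darts ?N"
      proof
        fix C assume "C \<in> h ` D"
        then obtain x where "x \<in> ?G" "C = h (grid_dart d x)" using grid_dart_surj[OF d(1)] by blast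
        then show "C \<in> darts ?N" using h_eq by (simp add: quotientI)
      qed
      show "darts ?N \<subseteq> h ` D"
      proof
        fix C assume "C \<in> darts ?N"
        then obtain x where "x \<in> ?G" "C = lattice_rel a r 3 `` {x}"
          unfolding torus_simps by (rule quotientE)
        then show "C \<in> h ` D" using h_eq grid_dart_in[OF d(1)] by blast
      qed
    qed
  qed
  moreover have "h (J e) = opp ?N (h e)" if "e \<in> D" for e
  proof -
    have inv: "opp grid_map x \<in> ?G \<and> opp grid_map (opp grid_map x) = x" if "x \<in> ?G" for x
      using that by (auto simp: dirs_def)
    show ?thesis
    proof (intro set_eqI iffI)
      fix x assume "x \<in> h (J e)"
      then have "opp grid_map x \<in> h e" "x = opp grid_map (opp grid_map x)"
        using inv[of x] grid_dart_opp[OF d(1), of x] \<open>e \<in> D\<close> by (auto simp: h_def)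
      then show "x \<in> opp ?N (h e)" unfolding torus_simps by blast
    next
      fix x assume "x \<in> opp ?N (h e)"
      then show "x \<in> h (J e)" using inv grid_dart_opp[OF d(1)] by (auto simp: h_def simp del: grid_simps)
    qed
  qed
  moreover have "h (R e) = nxt ?N (h e)" if "e \<in> D" for e
  proof -
    have inv: "nxt grid_map x \<in> ?G \<and> nxt grid_map (nxt grid_map (nxt grid_map (nxt grid_map x))) = x" if "x \<in> ?G" for x
      using that by (auto simp: dirs_def)
    show ?thesis
    proof (intro set_eqI iffI)
      fix x assume "x \<in> h (R e)"
      then have "nxt grid_map (nxt grid_map (nxt grid_map x)) \<in> h e"
        "x = nxt grid_map (nxt grid_map (nxt grid_map (nxt grid_map x)))"
        using inv grid_dart_nxt[OF d(1)] \<open>e \<in> D\<close> by (auto simp: h_def simp del: grid_simps)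
      then show "x \<in> nxt ?N (h e)" unfolding torus_simps by blast
    next
      fix x assume "x \<in> nxt ?N (h e)"
      then show "x \<in> h (R e)" using inv grid_dart_nxt[OF d(1)] by (auto simp: h_def simp del: grid_simps)
    qed
  qed
  ultimately have "map_iso M ?N" unfolding map_iso_def M by blast
  then show ?thesis using ar by blast
qed

lemma connectivity_torus_quad:
  assumes "darts M = D" "opp M = J" "nxt M = R"
  shows "vertex_connectivity V E \<in> {6, 8} \<and>
    (k_connected V E 8 \<longleftrightarrow> \<not> (\<exists>a r. a \<ge> 4 \<and> r \<ge> 0 \<and> map_iso M (torus_quad a r 3)))"
  using connectivity iso_imp[OF assms] imp_iso[OF assms] by blast

end

section \<open>Faces of the planarization\<close>

text \<open>\<open>orbit\<close> collects positive iterates only, so a return to \<open>x\<close>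
  has to be proved. It holds because \<open>f\<close> permutes the finite set
  \<open>A\<close>.\<close>

lemma self_in_orbit:
  assumes "finite A" "\<And>x. x \<in> A \<Longrightarrow> f x \<in> A" "inj_on f A" "x \<in> A"
  shows "x \<in> orbit f x"
proof -
  let ?g = "perm_restrict f A"
  have "f ` A = A" using assms(1-3) by (intro endo_inj_surj) auto
  then have "bij_betw ?g A A"
    using assms(3) by (simp add: bij_betw_def perm_restrict_def inj_on_def)
  then have "?g permutes A" by (rule bij_imp_permutes) (simp add: perm_restrict_def)
  then have "x \<in> orbit ?g x"
    using assms(1) by (intro permutation_self_in_orbit permutes_imp_permutation)
  also have "orbit ?g x = orbit f x"
    by (rule orbit_cong0[symmetric, of x A]) (use assms(2,4) in \<open>auto simp: perm_restrict_def\<close>)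
  finally show ?thesis .
qed

lemma orbit_in:
  assumes "\<And>x. x \<in> A \<Longrightarrow> f x \<in> A" "x \<in> A"
  shows "orbit f x \<subseteq> A"
proof
  fix y assume "y \<in> orbit f x"
  then show "y \<in> A" by induction (use assms in auto)
qed

lemma sum_card_orbits:
  assumes A: "finite A" "\<And>x. x \<in> A \<Longrightarrow> f x \<in> A" "inj_on f A"
  shows "(\<Sum>B\<in>orbit f ` A. card {y \<in> B. P y}) = card {y \<in> A. P y}"
proof -
  have self: "x \<in> orbit f x" if "x \<in> A" for x using self_in_orbit[OF A that] .
  have sub: "orbit f x \<subseteq> A" if "x \<in> A" for x using orbit_in[of A f, OF A(2) that] .
  have "{y \<in> A. P y} = (\<Union>B\<in>orbit f ` A. {y \<in> B. P y})"
    using self sub by blast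
  also have "card \<dots> = (\<Sum>B\<in>orbit f ` A. card {y \<in> B. P y})"
  proof (rule card_UN_disjoint)
    show "\<forall>B\<in>orbit f ` A. finite {y \<in> B. P y}"
      using finite_subset[OF sub A(1)] by auto
    show "\<forall>B\<in>orbit f ` A. \<forall>B'\<in>orbit f ` A. B \<noteq> B' \<longrightarrow> {y \<in> B. P y} \<inter> {y \<in> B'. P y} = {}"
    proof (intro ballI impI)
      fix B B' assume B: "B \<in> orbit f ` A" "B' \<in> orbit f ` A" "B \<noteq> B'"
      then obtain x x' where x: "x \<in> A" "B = orbit f x" "x' \<in> A" "B' = orbit f x'" by blast
      have cyc: "cyclic_on f B" "cyclic_on f B'"
        using x self by (auto intro: cyclic_on_singleI)
      show "{y \<in> B. P y} \<inter> {y \<in> B'. P y} = {}"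
        using orbit_cyclic_eq3[OF cyc(1)] orbit_cyclic_eq3[OF cyc(2)] B(3) by blast
    qed
  qed (use A in simp)
  finally show ?thesis by simp
qed

lemma cyclic_on_funpow_card:
  assumes "cyclic_on f S" "y \<in> S"
  shows "(f ^^ card S) y = y"
proof -
  let ?n = "funpow_dist1 f y y"
  have S: "S = orbit f y" using orbit_cyclic_eq3[OF assms] by simp
  then have self: "y \<in> orbit f y" using assms(2) by simp
  have ret: "(f ^^ ?n) y = y" by (rule funpow_dist1_prop[OF self])
  then have "S = (\<lambda>n. (f ^^ n) y) ` {0..<?n}"
    unfolding S by (subst orbit_altdef_bounded[OF ret]) auto
  then have "card S = ?n" using card_image[OF inj_on_funpow_dist1[OF self]] by simp
  then show ?thesis using ret by simp
qed

lemma cyclic_on_inj: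
  assumes "cyclic_on f S"
  shows "inj_on f S"
proof -
  have fin: "finite S" using assms by (rule finite_cyclic_on)
  have "f ` S = S"
  proof
    show "f ` S \<subseteq> S" using cyclic_on_inI[OF assms] by blast
    show "S \<subseteq> f ` S"
    proof
      fix y assume y: "y \<in> S"
      then have "card S \<noteq> 0" using fin by auto
      then obtain n where "card S = Suc n" by (cases "card S") auto
      then have "f ((f ^^ n) y) = y" using cyclic_on_funpow_card[OF assms y] by simp
      moreover have "(f ^^ n) y \<in> S" using cyclic_on_funpow_in[OF assms y] .
      ultimately show "y \<in> f ` S" by (metis imageI)
    qed
  qed
  then show ?thesis using fin by (metis finite_surj_inj subset_refl)
qed

section \<open>Euler count in the planarization\<close>

locale optimal_drawing =
  fixes V :: "'a set" and E :: "'a set set" and X :: "'a set set set"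
    and \<rho> :: "'a point \<Rightarrow> 'a point \<Rightarrow> 'a point"
  assumes optimal: "optimal_one_toroidal V E X \<rho>" and reg: "regular V E 8"
begin

abbreviation adj where "adj \<equiv> adjacent_points E X"

definition Nb where "Nb x = {y. adj x y}"

lemma graph: "simple_graph V E" and conn: "connected_on E V" and pairs: "crossing_pairs E X"
  and alternating: "\<And>c e u. c \<in> X \<Longrightarrow> e \<in> c \<Longrightarrow> u \<in> e \<Longrightarrow> \<rho> (Cross c) (Vert u) \<notin> Vert ` e"
  and euler: "0 \<le> euler_char (planarization E X \<rho>)"
  and cyclic: "\<And>x. x \<in> points V X \<Longrightarrow> Nb x \<noteq> {} \<Longrightarrow> cyclic_on (\<rho> x) (Nb x)"
  using optimal unfolding optimal_one_toroidal_def one_toroidal_def one_embedding_def Nb_def by blast+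

lemma finite_V: "finite V" using graph by (simp add: simple_graph_def)

lemma finite_E: "finite E"
proof (rule finite_subset)
  show "E \<subseteq> Pow V" using graph by (auto simp: simple_graph_def)
qed (simp add: finite_V)

lemma edgeD: "e \<in> E \<Longrightarrow> e \<subseteq> V \<and> card e = 2"
  using graph by (simp add: simple_graph_def)

lemma crossD:
  assumes "c \<in> X"
  obtains e f where "e \<in> E" "f \<in> E" "c = {e, f}" "e \<inter> f = {}" "e \<noteq> f"
proof -
  have "\<forall>c\<in>X. \<exists>e\<in>E. \<exists>f\<in>E. c = {e, f} \<and> e \<inter> f = {}"
    using pairs unfolding crossing_pairs_def by (rule conjunct1)
  from bspec[OF this assms] obtain e f where ef: "e \<in> E" "f \<in> E" "c = {e, f}" "e \<inter> f = {}"
    by (elim bexE conjE) rule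
  have "e \<noteq> f"
  proof
    assume "e = f"
    then have "e = {}" using ef(4) by simp
    then show False using edgeD[OF ef(1)] by simp
  qed
  then show ?thesis by (rule that[OF ef])
qed

lemma cross_edge_in_E: "c \<in> X \<Longrightarrow> e \<in> c \<Longrightarrow> e \<in> E"
  by (erule crossD) blast

lemma cross_disjoint: "c \<in> X \<Longrightarrow> e \<in> c \<Longrightarrow> f \<in> c \<Longrightarrow> u \<in> e \<Longrightarrow> u \<in> f \<Longrightarrow> e = f"
  by (erule crossD) blast

lemma cross_unique: "c \<in> X \<Longrightarrow> c' \<in> X \<Longrightarrow> e \<in> c \<Longrightarrow> e \<in> c' \<Longrightarrow> c = c'"
  using pairs unfolding crossing_pairs_def pairwise_def disjnt_def by blast

lemma finite_X: "finite X"
proof (rule finite_subset)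
  show "X \<subseteq> Pow E" using cross_edge_in_E by blast
qed (simp add: finite_E)

lemma adj_sym: "adj x y \<Longrightarrow> adj y x"
  by (cases x; cases y) (auto simp: insert_commute)

lemma adj_irrefl: "\<not> adj x x"
proof (cases x)
  case (Vert u)
  then show ?thesis using edgeD[of "{u}"] by (auto simp: noncrossing_edges_def)
qed simp

lemma adj_points: "adj x y \<Longrightarrow> x \<in> points V X"
proof (cases x)
  case (Vert u)
  assume "adj x y"
  then have "u \<in> V"
    using Vert edgeD cross_edge_in_E
    by (cases y) (fastforce simp: noncrossing_edges_def)+
  then show ?thesis using Vert by (simp add: points_def)
next
  case (Cross c)
  assume "adj x y"
  then show ?thesis using Cross by (cases y) (auto simp: points_def)
qed

lemma card_Union_cross:
  assumes "c \<in> X"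
  shows "finite (\<Union>c)" "card (\<Union>c) = 4"
proof -
  obtain e f where ef: "e \<in> E" "f \<in> E" "c = {e, f}" "e \<inter> f = {}" by (rule crossD[OF assms])
  have "finite e" "finite f" "card e = 2" "card f = 2"
    using edgeD[OF ef(1)] edgeD[OF ef(2)] by (auto intro: card_ge_0_finite)
  then show "finite (\<Union>c)" "card (\<Union>c) = 4" using ef by (simp_all add: card_Un_disjoint)
qed

lemma Nb_Cross: "c \<in> X \<Longrightarrow> Nb (Cross c) = Vert ` \<Union>c"
proof (intro set_eqI iffI)
  fix y assume "c \<in> X" "y \<in> Nb (Cross c)"
  then show "y \<in> Vert ` \<Union>c" by (cases y) (auto simp: Nb_def)
qed (auto simp: Nb_def)

lemma card_Nb_Cross: "c \<in> X \<Longrightarrow> card (Nb (Cross c)) = 4"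
  using card_Union_cross by (simp add: Nb_Cross card_image inj_on_def)

text \<open>Planarizing preserves degrees: a non-crossing edge at \<open>v\<close> contributes its
  other end, a crossing edge its crossing. Distinct crossing edges at \<open>v\<close> have distinct
  crossings, since the two edges of a crossing are disjoint.\<close>

lemma card_Nb_Vert:
  assumes v: "v \<in> V"
  shows "card (Nb (Vert v)) = 8"
proof -
  let ?N1 = "{u. {v, u} \<in> noncrossing_edges E X}"
  let ?N2 = "{c \<in> X. v \<in> \<Union>c}"
  have Nb: "Nb (Vert v) = Vert ` ?N1 \<union> Cross ` ?N2"
  proof (intro set_eqI iffI)
    fix y assume "y \<in> Nb (Vert v)"
    then show "y \<in> Vert ` ?N1 \<union> Cross ` ?N2" by (cases y) (auto simp: Nb_def)
  qed (auto simp: Nb_def)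
  have "?N1 \<subseteq> V" using edgeD by (auto simp: noncrossing_edges_def)
  then have fin: "finite ?N1" "finite ?N2" using finite_V finite_subset finite_X by auto
  have "card (Nb (Vert v)) = card (Vert ` ?N1 :: 'a point set) + card (Cross ` ?N2 :: 'a point set)"
    unfolding Nb using fin by (intro card_Un_disjoint) auto
  then have sum: "card (Nb (Vert v)) = card ?N1 + card ?N2"
    by (simp add: card_image inj_on_def)
  have 1: "card ?N1 = card {e \<in> noncrossing_edges E X. v \<in> e}"
  proof (rule bij_betw_same_card)
    show "bij_betw (\<lambda>u. {v, u}) ?N1 {e \<in> noncrossing_edges E X. v \<in> e}"
    proof (rule bij_betw_imageI)
      show "inj_on (\<lambda>u. {v, u}) ?N1" by (auto simp: inj_on_def doubleton_eq_iff)
      show "(\<lambda>u. {v, u}) ` ?N1 = {e \<in> noncrossing_edges E X. v \<in> e}"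
      proof (intro set_eqI iffI)
        fix e assume e: "e \<in> {e \<in> noncrossing_edges E X. v \<in> e}"
        then have "card e = 2" using edgeD by (auto simp: noncrossing_edges_def)
        then obtain u where "e = {v, u}" using e by (auto simp: card_2_iff)
        then show "e \<in> (\<lambda>u. {v, u}) ` ?N1" using e by auto
      qed auto
    qed
  qed
  let ?C = "{e \<in> \<Union>X. v \<in> e}"
  define g where "g e = (SOME c. c \<in> X \<and> e \<in> c)" for e
  have g: "g e = c" if "c \<in> X" "e \<in> c" for c e
  proof -
    have "g e \<in> X \<and> e \<in> g e" unfolding g_def by (rule someI[of _ c]) (use that in simp)
    then show ?thesis using cross_unique that by blast
  qed
  have 2: "card ?C = card ?N2"
  proof (rule bij_betw_same_card)
    show "bij_betw g ?C ?N2"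
    proof (rule bij_betw_imageI)
      show "inj_on g ?C"
      proof (rule inj_onI)
        fix e f assume "e \<in> ?C" "f \<in> ?C" "g e = g f"
        then obtain c where "c \<in> X" "e \<in> c" "f \<in> c" "v \<in> e" "v \<in> f" using g by auto
        then show "e = f" using cross_disjoint by blast
      qed
      show "g ` ?C = ?N2"
      proof (intro set_eqI iffI)
        fix c assume "c \<in> ?N2"
        then obtain e where "c \<in> X" "e \<in> c" "v \<in> e" by auto
        then show "c \<in> g ` ?C" using g[of c e] by force
      qed (use g in auto)
    qed
  qed
  have "{e \<in> E. v \<in> e} = {e \<in> noncrossing_edges E X. v \<in> e} \<union> ?C"
    using cross_edge_in_E by (auto simp: noncrossing_edges_def)
  moreover have "card ({e \<in> noncrossing_edges E X. v \<in> e} \<union> ?C)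
      = card {e \<in> noncrossing_edges E X. v \<in> e} + card ?C"
  proof (rule card_Un_disjoint)
    show "finite {e \<in> noncrossing_edges E X. v \<in> e}"
      using finite_E by (rule finite_subset[rotated]) (auto simp: noncrossing_edges_def)
    show "finite ?C"
      using finite_E by (rule finite_subset[rotated]) (use cross_edge_in_E in auto)
  qed (auto simp: noncrossing_edges_def)
  moreover have "card {e \<in> E. v \<in> e} = 8"
    using reg v by (simp add: regular_def degree_def)
  ultimately show ?thesis using sum 1 2 by simp
qed

lemma card_Nb: "x \<in> points V X \<Longrightarrow> card (Nb x) = 4 \<or> card (Nb x) = 8"
  using card_Nb_Cross card_Nb_Vert by (auto simp: points_def)

lemma Nb_ne: "x \<in> points V X \<Longrightarrow> Nb x \<noteq> {}"
  using card_Nb[of x] by auto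

lemma finite_Nb: "x \<in> points V X \<Longrightarrow> finite (Nb x)"
  using card_Nb[of x] by (auto intro: card_ge_0_finite)

lemma rot: "x \<in> points V X \<Longrightarrow> cyclic_on (\<rho> x) (Nb x)"
  using cyclic Nb_ne by blast

lemma rot_in: "adj x y \<Longrightarrow> adj x (\<rho> x y)"
  using cyclic_on_inI[OF rot[OF adj_points]] by (auto simp: Nb_def)

lemma rot_inj: "adj x y \<Longrightarrow> adj x z \<Longrightarrow> \<rho> x y = \<rho> x z \<Longrightarrow> y = z"
  using cyclic_on_inj[OF rot[OF adj_points]] by (auto simp: Nb_def inj_on_def)

definition A where "A = {(x, y). adj x y}"

text \<open>The face permutation \<open>nxt o opp\<close> of the planarization. Each dart of an
  orbit stands for the corner of the face at its tail.\<close>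

definition \<phi> where "\<phi> = (\<lambda>(x, y). (y, \<rho> y x))"

lemma finite_points: "finite (points V X)"
  by (simp add: points_def finite_V finite_X)

lemma A_eq: "A = Sigma (points V X) Nb"
  using adj_points by (auto simp: A_def Nb_def)

lemma finite_A: "finite A"
  unfolding A_eq using finite_points finite_Nb by blast

lemma sum_points: "(\<Sum>x\<in>points V X. f x) = (\<Sum>v\<in>V. f (Vert v)) + (\<Sum>c\<in>X. f (Cross c))"
proof -
  have "(\<Sum>x\<in>points V X. f x) = (\<Sum>x\<in>Vert ` V. f x) + (\<Sum>x\<in>Cross ` X. f x)"
    unfolding points_def by (rule sum.union_disjoint) (auto simp: finite_V finite_X)
  then show ?thesis by (simp add: sum.reindex inj_on_def)
qed

lemma card_A: "card A = 8 * card V + 4 * card X"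
  unfolding A_eq using finite_points finite_Nb
  by (simp add: sum_points card_Nb_Vert card_Nb_Cross)

lemma card_cross_darts: "card {d \<in> A. fst d \<in> range Cross} = 4 * card X"
proof -
  have "{d \<in> A. fst d \<in> range Cross} = Sigma (Cross ` X) Nb"
    unfolding A_eq by (auto simp: points_def)
  moreover have "finite (Nb (Cross c))" if "c \<in> X" for c
    using that by (intro finite_Nb) (simp add: points_def)
  ultimately show ?thesis
    by (simp add: finite_X card_SigmaI sum.reindex inj_on_def card_Nb_Cross)
qed

lemma phi_in: "d \<in> A \<Longrightarrow> \<phi> d \<in> A"
  using rot_in adj_sym by (fastforce simp: A_def \<phi>_def)

lemma phi_inj: "inj_on \<phi> A"
  using rot_inj adj_sym by (auto simp: inj_on_def A_def \<phi>_def) blast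

text \<open>Every point has four or eight neighbours, so none is missed when vertices are counted as
  orbits of darts.\<close>

lemma card_vertex_orbits:
  "card (orbit (nxt (planarization E X \<rho>)) ` A) = card V + card X"
proof -
  let ?n = "nxt (planarization E X \<rho>)"
  have pow: "(?n ^^ n) (x, y) = (x, (\<rho> x ^^ n) y)" for n x y
    by (induction n) (simp_all add: planarization_def)
  have "orbit ?n (x, y) = {x} \<times> Nb x" if "x \<in> points V X" "y \<in> Nb x" for x y
  proof -
    have "orbit ?n (x, y) = {x} \<times> orbit (\<rho> x) y"
      unfolding orbit_altdef pow by auto
    then show ?thesis using orbit_cyclic_eq3[OF rot[OF that(1)] that(2)] by simp
  qed
  then have "orbit ?n ` A = (\<lambda>x. {x} \<times> Nb x) ` points V X"
    unfolding A_eq using Nb_ne by (force simp: image_iff)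
  moreover have "inj_on (\<lambda>x. {x} \<times> Nb x) (points V X)"
    using Nb_ne by (intro inj_onI) blast
  moreover have "card (points V X) = card V + card X"
    using sum_points[of "\<lambda>_. 1 :: nat"] by simp
  ultimately show ?thesis by (simp add: card_image)
qed

lemma card_edge_orbits:
  "2 * card (orbit (opp (planarization E X \<rho>)) ` A) = card A"
proof -
  let ?o = "opp (planarization E X \<rho>)"
  have o: "?o d \<in> A" "?o (?o d) = d" "?o d \<noteq> d" if "d \<in> A" for d
    using that adj_sym adj_irrefl by (auto simp: A_def planarization_def)
  then have inj: "inj_on ?o A" by (metis inj_onI)
  have orb: "orbit ?o d = {d, ?o d}" if "d \<in> A" for d
  proof -
    have "(?o ^^ 2) d = d" using o(2)[OF that] by (simp add: numeral_2_eq_2)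
    then have "orbit ?o d = {(?o ^^ m) d | m. m < 2}" by (rule orbit_altdef_bounded) simp
    also have "\<dots> = {d, ?o d}" by (auto simp: less_2_cases_iff intro: exI[of _ 0] exI[of _ 1])
    finally show ?thesis .
  qed
  have "card (orbit ?o d) = 2" if "d \<in> A" for d
    unfolding orb[OF that] using o(3)[OF that] by (metis card_2_iff)
  then have "(\<Sum>B\<in>orbit ?o ` A. card B) = (\<Sum>B\<in>orbit ?o ` A. 2)"
    by (intro sum.cong) auto
  then show ?thesis
    using sum_card_orbits[of A ?o "\<lambda>_. True", OF finite_A o(1) inj] by simp
qed

text \<open>The planarization has \<open>card V + card X\<close> points and, at two darts per edge,
  \<open>4 * card V + 2 * card X\<close> edges; the rest is Euler's inequality.\<close>

lemma card_faces: "3 * card V + card X \<le> card (orbit \<phi> ` A)"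
proof -
  have d: "darts (planarization E X \<rho>) = A" by (simp add: planarization_def A_def)
  have f: "nxt (planarization E X \<rho>) \<circ> opp (planarization E X \<rho>) = \<phi>"
    by (auto simp: planarization_def \<phi>_def)
  show ?thesis
    using euler card_edge_orbits card_A unfolding euler_char_def d f card_vertex_orbits by linarith
qed

text \<open>A face of length 2 would make the rotation at one of its points fix a neighbour, so that
  this point would have degree 1.\<close>

lemma face_card_ge:
  assumes d: "d \<in> A"
  shows "\<phi> d \<noteq> d" "\<phi> (\<phi> d) \<noteq> d" "3 \<le> card (orbit \<phi> d)"
proof -
  obtain x y where xy: "d = (x, y)" "adj x y" using d by (auto simp: A_def)
  show 1: "\<phi> d \<noteq> d" using xy adj_irrefl by (auto simp: \<phi>_def)
  show 2: "\<phi> (\<phi> d) \<noteq> d"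
  proof
    assume "\<phi> (\<phi> d) = d"
    then have "\<rho> y x = x" by (simp add: \<phi>_def xy)
    then have "orbit (\<rho> y) x = {x}" by (simp add: orbit_eq_singleton_iff)
    moreover have "x \<in> Nb y" "y \<in> points V X" using xy adj_sym adj_points by (auto simp: Nb_def)
    ultimately have "Nb y = {x}" using orbit_cyclic_eq3[OF rot] by metis
    then show False using card_Nb[OF \<open>y \<in> points V X\<close>] by simp
  qed
  have 3: "\<phi> (\<phi> d) \<noteq> \<phi> d" using 1 phi_inj phi_in[OF d] d by (metis inj_onD)
  have self: "d \<in> orbit \<phi> d" by (rule self_in_orbit[OF finite_A phi_in phi_inj d])
  have "card {d, \<phi> d, \<phi> (\<phi> d)} = 3" using 1 2 3 by auto
  moreover have "{d, \<phi> d, \<phi> (\<phi> d)} \<subseteq> orbit \<phi> d"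
    using self by (auto intro: orbit.intros)
  ultimately show "3 \<le> card (orbit \<phi> d)"
    using card_mono[OF finite_orbit[OF self]] by metis
qed

text \<open>Two crossings are never adjacent, so \<open>\<phi>\<close> maps the corners at crossings
  injectively to corners at vertices.\<close>

lemma cross_corners_le:
  assumes d: "d \<in> A"
  shows "2 * card {e \<in> orbit \<phi> d. fst e \<in> range Cross} \<le> card (orbit \<phi> d)"
proof -
  let ?B = "orbit \<phi> d"
  let ?C = "{e \<in> ?B. fst e \<in> range Cross}"
  have fin: "finite ?B" by (rule finite_orbit[OF self_in_orbit[OF finite_A phi_in phi_inj d]])
  have sub: "?B \<subseteq> A" using orbit_in[of A \<phi>, OF phi_in d] .
  have "\<phi> ` ?C \<subseteq> ?B - ?C"
  proof
    fix e assume "e \<in> \<phi> ` ?C"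
    then obtain c y where c: "(Cross c, y) \<in> ?B" "e = \<phi> (Cross c, y)" by auto
    then have "adj (Cross c) y" using sub by (auto simp: A_def)
    then have "y \<notin> range Cross" by auto
    then have "fst e \<notin> range Cross" using c(2) by (simp add: \<phi>_def)
    moreover have "e \<in> ?B" unfolding c(2) by (rule orbit.step[OF c(1)])
    ultimately show "e \<in> ?B - ?C" by blast
  qed
  then have "card (\<phi> ` ?C) \<le> card (?B - ?C)" using fin by (intro card_mono) auto
  moreover have "card (\<phi> ` ?C) = card ?C"
    using sub by (intro card_image inj_on_subset[OF phi_inj]) auto
  moreover have "card (?B - ?C) = card ?B - card ?C" using fin by (intro card_Diff_subset) auto
  moreover have "card ?C \<le> card ?B" using fin by (intro card_mono) auto
  ultimately show ?thesis by simp
qed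

lemma faces_are_triangles:
  assumes d: "d \<in> A"
  shows "card (orbit \<phi> d) = 3" "card {e \<in> orbit \<phi> d. fst e \<in> range Cross} = 1"
proof -
  let ?F = "orbit \<phi> ` A"
  let ?x = "\<lambda>B. card {e \<in> B. fst e \<in> range Cross}"
  have fin: "finite ?F" using finite_A by simp
  have le: "?x B + 8 \<le> 3 * card B" if B: "B \<in> ?F" for B
  proof -
    obtain e where e: "e \<in> A" "B = orbit \<phi> e" using B by blast
    show ?thesis
    \<comment> \<open>For length 3 the bound needs rounding, as \<open>2 * x <= 3\<close> gives
      \<open>x <= 1\<close>; from length 4 on, \<open>2 * x <= k\<close> is enough.\<close>
    proof (cases "card B = 3")
      case True
      then show ?thesis using cross_corners_le[OF e(1)] e(2) by simp
    next
      case False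
      then show ?thesis using cross_corners_le[OF e(1)] face_card_ge(3)[OF e(1)] e(2) by simp
    qed
  qed
  have "(\<Sum>B\<in>?F. ?x B + 8) = 4 * card X + 8 * card ?F"
    using sum_card_orbits[of A \<phi> "\<lambda>e. fst e \<in> range Cross", OF finite_A phi_in phi_inj]
    by (simp add: sum.distrib card_cross_darts)
  moreover have "(\<Sum>B\<in>?F. 3 * card B) = 3 * card A"
    using sum_card_orbits[of A \<phi> "\<lambda>_. True", OF finite_A phi_in phi_inj]
    by (simp flip: sum_distrib_left)
  \<comment> \<open>With \<open>card A = 8 |V| + 4 |X|\<close> and at least \<open>3 |V| + |X|\<close> faces, the total of \<open>3 k - x - 8\<close> is at most \<open>0\<close>.\<close>
  ultimately have "(\<Sum>B\<in>?F. ?x B + 8) \<ge> (\<Sum>B\<in>?F. 3 * card B)"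
    using card_faces card_A by simp
  moreover have "(\<Sum>B\<in>?F. ?x B + 8) \<le> (\<Sum>B\<in>?F. 3 * card B)"
    using le by (rule sum_mono)
  ultimately have "(\<Sum>B\<in>?F. ?x B + 8) = (\<Sum>B\<in>?F. 3 * card B)" by simp
  then have "?x (orbit \<phi> d) + 8 = 3 * card (orbit \<phi> d)"
    by (rule sum_mono_inv) (use le fin d in auto)
  then show "card (orbit \<phi> d) = 3" "?x (orbit \<phi> d) = 1"
    using cross_corners_le[OF d] face_card_ge(3)[OF d] by linarith+
qed

text \<open>A face of three darts means that the third power of \<open>\<phi>\<close> fixes them.
  Read coordinatewise, this gives the rotations at its three corners.\<close>

lemma triangle:
  assumes xy: "adj x y"
  defines "z \<equiv> \<rho> y x"
  shows "\<rho> z y = x" "\<rho> x z = y"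
    "card {e \<in> {(x, y), (y, z), (z, x)}. fst e \<in> range Cross} = 1"
proof -
  let ?d = "(x, y)"
  have d: "?d \<in> A" using xy by (simp add: A_def)
  let ?B = "orbit \<phi> ?d"
  have B3: "card ?B = 3" by (rule faces_are_triangles(1)[OF d])
  have self: "?d \<in> ?B" by (rule self_in_orbit[OF finite_A phi_in phi_inj d])
  have ne: "\<phi> ?d \<noteq> ?d" "\<phi> (\<phi> ?d) \<noteq> ?d" "\<phi> (\<phi> ?d) \<noteq> \<phi> ?d" "\<phi> (\<phi> (\<phi> ?d)) \<noteq> \<phi> ?d"
      "\<phi> (\<phi> (\<phi> ?d)) \<noteq> \<phi> (\<phi> ?d)"
    using face_card_ge[OF d] face_card_ge[OF phi_in[OF d]] face_card_ge[OF phi_in[OF phi_in[OF d]]] by auto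
  have sub: "{?d, \<phi> ?d, \<phi> (\<phi> ?d)} \<subseteq> ?B"
    using self by (auto intro: orbit.intros)
  moreover have "card {?d, \<phi> ?d, \<phi> (\<phi> ?d)} = 3" using ne by auto
  ultimately have B: "?B = {?d, \<phi> ?d, \<phi> (\<phi> ?d)}"
    using B3 finite_orbit[OF self] by (metis card_subset_eq)
  have "\<phi> (\<phi> (\<phi> ?d)) \<in> ?B" by (auto intro: orbit.intros)
  then have "\<phi> (\<phi> (\<phi> ?d)) = ?d" unfolding B using ne by auto
  then show 1: "\<rho> z y = x" "\<rho> x z = y" by (auto simp: \<phi>_def z_def)
  have "\<phi> ?d = (y, z)" "\<phi> (\<phi> ?d) = (z, x)" using 1 by (simp_all add: \<phi>_def z_def)
  then show "card {e \<in> {(x, y), (y, z), (z, x)}. fst e \<in> range Cross} = 1"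
    using faces_are_triangles(2)[OF d] unfolding B by simp
qed

end

section \<open>The quadrangulation by non-crossing edges\<close>

context optimal_drawing
begin

lemma adj_Cross_Vert [simp]: "adj (Cross c) y \<Longrightarrow> \<exists>v. y = Vert v"
  by (cases y) auto

text \<open>The triangle next to a non-crossing edge must contain a crossing, which can only be its
  third corner.\<close>

lemma rot_edge:
  assumes uv: "{u, v} \<in> noncrossing_edges E X"
  obtains c where "c \<in> X" "v \<in> \<Union>c" "\<rho> (Vert v) (Vert u) = Cross c" "\<rho> (Cross c) (Vert v) = Vert u"
proof -
  have a: "adj (Vert u) (Vert v)" using uv by simp
  let ?z = "\<rho> (Vert v) (Vert u)"
  have az: "adj (Vert v) ?z" using rot_in[OF adj_sym[OF a]] .
  show ?thesis
  proof (cases ?z)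
    case (Vert w)
    then have "{e \<in> {(Vert u, Vert v), (Vert v, ?z), (?z, Vert u)}. fst e \<in> range Cross} = {}" by auto
    then show ?thesis using triangle(3)[OF a] by (metis card.empty zero_neq_one)
  next
    case (Cross c)
    then show ?thesis using that[of c] az triangle(1)[OF a] by simp
  qed
qed

lemma corner:
  assumes c: "c \<in> X" "v \<in> \<Union>c"
  obtains u w where "u \<in> \<Union>c" "w \<in> \<Union>c"
    "{u, v} \<in> noncrossing_edges E X" "{v, w} \<in> noncrossing_edges E X"
    "\<rho> (Cross c) (Vert v) = Vert u" "\<rho> (Cross c) (Vert w) = Vert v"
    "\<rho> (Vert v) (Vert u) = Cross c" "\<rho> (Vert v) (Cross c) = Vert w"
    "\<rho> (Vert u) (Cross c) = Vert v"
proof -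
  have a: "adj (Cross c) (Vert v)" "adj (Vert v) (Cross c)" using c by auto
  let ?z = "\<rho> (Vert v) (Cross c)"
  have az: "adj (Vert v) ?z" using rot_in[OF a(2)] .
  have "?z \<notin> range Cross"
  proof
    assume z: "?z \<in> range Cross"
    let ?S = "{e \<in> {(Cross c, Vert v), (Vert v, ?z), (?z, Cross c)}. fst e \<in> range Cross}"
    let ?T = "{(Cross c, Vert v), (?z, Cross c)}"
    have "?T \<subseteq> ?S" using z by auto
    moreover have "finite ?S" by simp
    ultimately have "card ?T \<le> card ?S" by (intro card_mono)
    moreover have "card ?T = 2" by (simp add: card_2_iff)
    ultimately have "2 \<le> card ?S" by simp
    then show False using triangle(3)[OF a(1)] by simp
  qed
  then obtain w where w: "?z = Vert w" by (cases ?z) auto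
  have cw: "\<rho> (Cross c) (Vert w) = Vert v" using triangle(2)[OF a(1)] w by simp
  have "\<rho> (Vert w) (Vert v) = Cross c" using triangle(1)[OF a(1)] w by simp
  moreover have "adj (Vert w) (Vert v)" using az w adj_sym by metis
  ultimately have "adj (Vert w) (Cross c)" using rot_in by metis
  then have w_in: "w \<in> \<Union>c" by simp
  obtain u where u: "\<rho> (Cross c) (Vert v) = Vert u" using rot_in[OF a(1)] adj_Cross_Vert by blast
  then have ac: "adj (Vert u) (Cross c)" using rot_in[OF a(1)] adj_sym by metis
  have vu: "\<rho> (Vert v) (Vert u) = Cross c" "\<rho> (Vert u) (Cross c) = Vert v"
    using triangle(1,2)[OF a(2)] u by simp_all
  then have "adj (Vert u) (Vert v)" using rot_in[OF ac] by simp
  then show ?thesis using that[of u w] w_in ac az w cw u vu by simp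
qed

lemma noncrossing_V: "{u, v} \<in> noncrossing_edges E X \<Longrightarrow> u \<in> V"
  using edgeD by (auto simp: noncrossing_edges_def)

lemma rot4_Cross:
  assumes "c \<in> X" "v \<in> \<Union>c"
  shows "\<rho> (Cross c) (\<rho> (Cross c) (\<rho> (Cross c) (\<rho> (Cross c) (Vert v)))) = Vert v"
proof -
  have "Cross c \<in> points V X" "Vert v \<in> Nb (Cross c)"
    using assms by (auto simp: points_def Nb_def)
  then have "(\<rho> (Cross c) ^^ 4) (Vert v) = Vert v"
    using cyclic_on_funpow_card[OF rot] card_Nb_Cross[OF assms(1)] by metis
  then show ?thesis by (simp add: eval_nat_numeral)
qed

lemma rot8_Vert:
  assumes "adj (Vert v) y"
  shows "(\<rho> (Vert v) ^^ 8) y = y"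
proof -
  have "Vert v \<in> points V X" "y \<in> Nb (Vert v)"
    using assms adj_points by (auto simp: Nb_def)
  moreover from this have "card (Nb (Vert v)) = 8" using card_Nb_Vert by (auto simp: points_def)
  ultimately show ?thesis
    using cyclic_on_funpow_card[OF rot, of "Vert v" y] by simp
qed

text \<open>Half-edges of the two crossing edges alternate around \<open>c\<close>, so two rotation
  steps lead back to the edge of \<open>w\<close>. They do not lead back to \<open>w\<close> itself,
  because the rotation is one cycle of length 4.\<close>

lemma diagonal:
  assumes c: "c \<in> X" "w \<in> \<Union>c" and x: "\<rho> (Cross c) (Vert w) = Vert x" and u: "\<rho> (Cross c) (Vert x) = Vert u"
  shows "{u, w} \<in> c" "u \<noteq> w"
proof -
  have a: "adj (Cross c) (Vert w)" using c by auto
  then have ax: "adj (Cross c) (Vert x)" "adj (Cross c) (Vert u)" using rot_in x u by metis+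
  show uw: "u \<noteq> w"
  proof
    assume "u = w"
    then have "(\<rho> (Cross c) ^^ 2) (Vert w) = Vert w" using x u by (simp add: eval_nat_numeral)
    then have "orbit (\<rho> (Cross c)) (Vert w) = {(\<rho> (Cross c) ^^ m) (Vert w) | m. m < 2}"
      by (rule orbit_altdef_bounded) simp
    also have "\<dots> \<subseteq> {Vert w, Vert x}" using x by (auto simp: less_2_cases_iff)
    finally have "Nb (Cross c) \<subseteq> {Vert w, Vert x}"
      using orbit_cyclic_eq3[OF rot[OF adj_points[OF a]]] a by (auto simp: Nb_def)
    then have "card (Nb (Cross c)) \<le> card {Vert w, Vert x}" by (intro card_mono) auto
    also have "\<dots> \<le> 2" by (simp add: card_insert_if)
    finally show False using card_Nb_Cross[OF c(1)] by simp
  qed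
  obtain e where e: "e \<in> c" "w \<in> e" using c(2) by blast
  obtain f where f: "f \<in> c" "x \<in> f" using ax(1) by auto
  obtain g where g: "g \<in> c" "u \<in> g" using ax(2) by auto
  have "x \<notin> e" using alternating[OF c(1) e] x by auto
  moreover have "u \<notin> f" using alternating[OF c(1) f] u by auto
  ultimately have "e \<noteq> f" "g \<noteq> f" using f g by auto
  moreover obtain e' f' where "c = {e', f'}" by (rule crossD[OF c(1)])
  ultimately have "g = e" using e f g by auto
  then have "{u, w} \<subseteq> e" "card e = 2"
    using e g edgeD[OF cross_edge_in_E[OF c(1) e(1)]] by auto
  moreover have "card {u, w} = 2" using uw by simp
  ultimately have "e = {u, w}" by (metis card_subset_eq card_ge_0_finite zero_less_numeral)
  then show "{u, w} \<in> c" using e by simp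
qed

abbreviation Q where "Q \<equiv> quadrangular_subgraph E X \<rho>"

lemma darts_Q: "darts Q = {(Vert u, Vert v) | u v. {u, v} \<in> noncrossing_edges E X}"
  by (auto simp: quadrangular_subgraph_def submap_def planarization_def)

lemma opp_Q: "opp Q (x, y) = (y, x)"
  by (simp add: quadrangular_subgraph_def submap_def planarization_def)

text \<open>A crossing lies between consecutive non-crossing edges at a vertex, so the first return
  happens after exactly two steps.\<close>

lemma nxt_Q:
  assumes "{u, v} \<in> noncrossing_edges E X"
  shows "nxt Q (Vert v, Vert u) = (Vert v, \<rho> (Vert v) (\<rho> (Vert v) (Vert u)))"
proof -
  let ?n = "nxt (planarization E X \<rho>)"
  let ?D = "range Vert \<times> range Vert"
  obtain c where c: "c \<in> X" "v \<in> \<Union>c" "\<rho> (Vert v) (Vert u) = Cross c" by (rule rot_edge[OF assms]) blast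
  obtain w where w: "\<rho> (Vert v) (Cross c) = Vert w" by (rule corner[OF c(1,2)]) blast
  have n: "?n (Vert v, y) = (Vert v, \<rho> (Vert v) y)" for y by (simp add: planarization_def)
  have "(LEAST k. 0 < k \<and> (?n ^^ k) (Vert v, Vert u) \<in> ?D) = 2"
  proof (rule Least_equality)
    show "0 < (2::nat) \<and> (?n ^^ 2) (Vert v, Vert u) \<in> ?D"
      using c(3) w by (simp add: eval_nat_numeral n)
    fix k assume k: "0 < k \<and> (?n ^^ k) (Vert v, Vert u) \<in> ?D"
    show "2 \<le> k"
    proof (rule ccontr)
      assume "\<not> 2 \<le> k"
      then have "k = 1" using k by simp
      then show False using k c(3) by (auto simp: n)
    qed
  qed
  then show ?thesis
    by (simp add: quadrangular_subgraph_def submap_def n eval_nat_numeral)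
qed

lemma nxt_corner:
  assumes "c \<in> X" "v \<in> \<Union>c"
  obtains u w where "u \<in> \<Union>c" "w \<in> \<Union>c"
    "{u, v} \<in> noncrossing_edges E X" "{v, w} \<in> noncrossing_edges E X"
    "\<rho> (Cross c) (Vert v) = Vert u" "\<rho> (Cross c) (Vert w) = Vert v"
    "nxt Q (Vert v, Vert u) = (Vert v, Vert w)" "\<rho> (Vert v) (Cross c) = Vert w"
    "\<rho> (Vert u) (Cross c) = Vert v"
proof -
  obtain u w where *: "u \<in> \<Union>c" "w \<in> \<Union>c"
    "{u, v} \<in> noncrossing_edges E X" "{v, w} \<in> noncrossing_edges E X"
    "\<rho> (Cross c) (Vert v) = Vert u" "\<rho> (Cross c) (Vert w) = Vert v"
    "\<rho> (Vert v) (Vert u) = Cross c" "\<rho> (Vert v) (Cross c) = Vert w"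
    "\<rho> (Vert u) (Cross c) = Vert v"
    by (rule corner[OF assms]) blast
  then have "nxt Q (Vert v, Vert u) = (Vert v, Vert w)" by (simp add: nxt_Q)
  with * that show ?thesis by blast
qed

lemma nxt_dart:
  assumes "{u, v} \<in> noncrossing_edges E X"
  obtains c w where "c \<in> X" "v \<in> \<Union>c" "w \<in> \<Union>c" "{v, w} \<in> noncrossing_edges E X"
    "\<rho> (Cross c) (Vert v) = Vert u" "\<rho> (Cross c) (Vert w) = Vert v"
    "nxt Q (Vert v, Vert u) = (Vert v, Vert w)"
proof -
  obtain c where c: "c \<in> X" "v \<in> \<Union>c" "\<rho> (Cross c) (Vert v) = Vert u" by (rule rot_edge[OF assms]) blast
  obtain u' w where *: "w \<in> \<Union>c" "{v, w} \<in> noncrossing_edges E X" "\<rho> (Cross c) (Vert v) = Vert u'"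
    "\<rho> (Cross c) (Vert w) = Vert v" "nxt Q (Vert v, Vert u') = (Vert v, Vert w)"
    by (rule nxt_corner[OF c(1,2)]) blast
  then have "u' = u" using c(3) by simp
  with * c that show ?thesis by blast
qed

definition tail :: "'a point \<times> 'a point \<Rightarrow> 'a" where
  "tail d = (THE v. fst d = Vert v)"

lemma tail_simp [simp]: "tail (Vert v, y) = v"
  by (simp add: tail_def)

lemma dartE:
  assumes "d \<in> darts Q"
  obtains u v where "d = (Vert v, Vert u)" "{u, v} \<in> noncrossing_edges E X"
  using assms unfolding darts_Q by (auto simp: insert_commute)

lemma dartI: "{v, u} \<in> noncrossing_edges E X \<Longrightarrow> (Vert v, Vert u) \<in> darts Q"
  unfolding darts_Q by blast

lemma nxt_Q_in:
  assumes "d \<in> darts Q"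
  shows "nxt Q d \<in> darts Q \<and> tail (nxt Q d) = tail d"
proof -
  obtain u v where d: "d = (Vert v, Vert u)" "{u, v} \<in> noncrossing_edges E X" by (rule dartE[OF assms])
  obtain w where "{v, w} \<in> noncrossing_edges E X" "nxt Q (Vert v, Vert u) = (Vert v, Vert w)"
    by (rule nxt_dart[OF d(2)]) blast
  then show ?thesis using d dartI by simp
qed

lemma nxt_Q_pow:
  assumes "{u, v} \<in> noncrossing_edges E X"
  shows "(nxt Q ^^ n) (Vert v, Vert u) = (Vert v, (\<rho> (Vert v) ^^ (2 * n)) (Vert u)) \<and>
    (\<exists>w. (\<rho> (Vert v) ^^ (2 * n)) (Vert u) = Vert w \<and> {w, v} \<in> noncrossing_edges E X)"
proof (induction n)
  case (Suc n)
  then obtain w where w: "(\<rho> (Vert v) ^^ (2 * n)) (Vert u) = Vert w" "{w, v} \<in> noncrossing_edges E X"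
    "(nxt Q ^^ n) (Vert v, Vert u) = (Vert v, Vert w)" by auto
  obtain w' where w': "{v, w'} \<in> noncrossing_edges E X" "nxt Q (Vert v, Vert w) = (Vert v, Vert w')"
    by (rule nxt_dart[OF w(2)]) blast
  then have "\<rho> (Vert v) (\<rho> (Vert v) (Vert w)) = Vert w'" using nxt_Q[OF w(2)] by simp
  then show ?case using w w' by (simp add: insert_commute)
qed (use assms in simp)

lemma square_map_Q: "square_map V E (darts Q) (nxt Q) (opp Q) tail"
proof
  show "nxt Q d \<in> darts Q" "tail (nxt Q d) = tail d" if "d \<in> darts Q" for d
    using nxt_Q_in[OF that] by auto
  show "opp Q d \<in> darts Q" "opp Q (opp Q d) = d" if "d \<in> darts Q" for d
    using that by (auto simp: darts_Q opp_Q insert_commute)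
  show "nxt Q (nxt Q (nxt Q (nxt Q d))) = d" if d_in: "d \<in> darts Q" for d
  proof -
    obtain u v where d: "d = (Vert v, Vert u)" "{u, v} \<in> noncrossing_edges E X" by (rule dartE[OF d_in])
    have "(nxt Q ^^ 4) d = (Vert v, (\<rho> (Vert v) ^^ 8) (Vert u))"
      using nxt_Q_pow[OF d(2), of 4] d(1) by simp
    also have "\<dots> = d" using rot8_Vert[of v "Vert u"] d by (simp add: insert_commute)
    finally show ?thesis by (simp add: eval_nat_numeral)
  qed
  show "nxt Q (opp Q (nxt Q (opp Q (nxt Q (opp Q (nxt Q (opp Q d))))))) = d" if d_in: "d \<in> darts Q" for d
  proof -
    obtain u v where d: "d = (Vert v, Vert u)" "{u, v} \<in> noncrossing_edges E X" by (rule dartE[OF d_in])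
    obtain c where c: "c \<in> X" "u \<in> \<Union>c" "\<rho> (Cross c) (Vert u) = Vert v"
      by (rule rot_edge[of v u]) (use d(2) in \<open>auto simp: insert_commute\<close>)
    \<comment> \<open>Each \<open>nxt Q o opp Q\<close> moves one corner backwards in the rotation
      at \<open>c\<close>, so the walk closes after the four corners around
      \<open>c\<close>.\<close>
    have step: "\<exists>w. w \<in> \<Union>c \<and> \<rho> (Cross c) (Vert w) = Vert v \<and> nxt Q (opp Q (\<rho> (Cross c) (Vert v), Vert v)) = (Vert v, Vert w)"
      if "v \<in> \<Union>c" for v
      by (rule nxt_corner[OF c(1) that]) (auto simp: opp_Q)
    obtain w1 where 1: "w1 \<in> \<Union>c" "\<rho> (Cross c) (Vert w1) = Vert u"
      "nxt Q (opp Q (\<rho> (Cross c) (Vert u), Vert u)) = (Vert u, Vert w1)" using step[OF c(2)] by blast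
    obtain w2 where 2: "w2 \<in> \<Union>c" "\<rho> (Cross c) (Vert w2) = Vert w1"
      "nxt Q (opp Q (\<rho> (Cross c) (Vert w1), Vert w1)) = (Vert w1, Vert w2)" using step[OF 1(1)] by blast
    obtain w3 where 3: "w3 \<in> \<Union>c" "\<rho> (Cross c) (Vert w3) = Vert w2"
      "nxt Q (opp Q (\<rho> (Cross c) (Vert w2), Vert w2)) = (Vert w2, Vert w3)" using step[OF 2(1)] by blast
    obtain w4 where 4: "w4 \<in> \<Union>c" "\<rho> (Cross c) (Vert w4) = Vert w3"
      "nxt Q (opp Q (\<rho> (Cross c) (Vert w3), Vert w3)) = (Vert w3, Vert w4)" using step[OF 3(1)] by blast
    have "w4 = u" using rot4_Cross[OF c(1) 4(1)] 1 2 3 4 by simp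
    then have "w3 = v" using c(3) 4(2) by simp
    then show ?thesis using 1 2 3 4 c(3) \<open>w4 = u\<close> d(1) by simp
  qed
  show "e \<in> {d, nxt Q d, nxt Q (nxt Q d), nxt Q (nxt Q (nxt Q d))}"
    if d: "d \<in> darts Q" and e: "e \<in> darts Q" and t: "tail d = tail e" for d e
  proof -
    obtain u v where d: "d = (Vert v, Vert u)" "{u, v} \<in> noncrossing_edges E X" by (rule dartE[OF d])
    obtain u' where e: "e = (Vert v, Vert u')" "{u', v} \<in> noncrossing_edges E X"
      by (rule dartE[OF e]) (use t d in auto)
    let ?r = "\<rho> (Vert v)"
    have a: "adj (Vert v) (Vert u)" "adj (Vert v) (Vert u')" using d(2) e(2) by (simp_all add: insert_commute)
    have "Vert u' \<in> orbit ?r (Vert u)"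
      using orbit_cyclic_eq3[OF rot[OF adj_points[OF a(1)]]] a by (auto simp: Nb_def)
    then obtain m where m: "m < 8" "Vert u' = (?r ^^ m) (Vert u)"
      using orbit_altdef_bounded[OF rot8_Vert[OF a(1)]] by auto
    \<comment> \<open>Starting from a vertex neighbour, the odd positions in the rotation at
      \<open>v\<close> are crossings.\<close>
    have "even m"
    proof (rule ccontr)
      assume "odd m"
      then obtain k where k: "m = Suc (2 * k)" by (auto elim: oddE)
      obtain w where w: "(?r ^^ (2 * k)) (Vert u) = Vert w" "{w, v} \<in> noncrossing_edges E X"
        using nxt_Q_pow[OF d(2), of k] by blast
      obtain c where "?r (Vert w) = Cross c" by (rule rot_edge[OF w(2)]) blast
      then show False using m(2) w(1) k by simp
    qed
    then obtain k where k: "m = 2 * k" by blast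
    then have "e = (nxt Q ^^ k) d" using nxt_Q_pow[OF d(2), of k] m(2) d(1) e(1) by simp
    moreover have "k = 0 \<or> k = 1 \<or> k = 2 \<or> k = 3" using k m(1) by auto
    ultimately show ?thesis by (auto simp: eval_nat_numeral)
  qed
  show "tail ` darts Q = V"
  proof (intro set_eqI iffI)
    fix v assume "v \<in> tail ` darts Q"
    then show "v \<in> V" using noncrossing_V by (auto simp: darts_Q)
  next
    fix v assume v: "v \<in> V"
    then obtain y where y: "adj (Vert v) y"
      using Nb_ne[of "Vert v"] by (auto simp: points_def Nb_def)
    have "\<exists>w. {v, w} \<in> noncrossing_edges E X"
    proof (cases y)
      case (Vert w)
      then show ?thesis using y by auto
    next
      case (Cross c)
      then have "c \<in> X" "v \<in> \<Union>c" using y by auto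
      then obtain w where "{v, w} \<in> noncrossing_edges E X" by (rule corner)
      then show ?thesis by blast
    qed
    then obtain w where "(Vert v, Vert w) \<in> darts Q" using dartI by blast
    then show "v \<in> tail ` darts Q" by (rule rev_image_eqI) simp
  qed
  show "{u, v} \<in> E \<longleftrightarrow> (\<exists>d\<in>darts Q. u = tail d \<and> (v = tail (opp Q d) \<or> v = tail (opp Q (nxt Q (opp Q d)))))"
    for u v
  proof
    assume uv: "{u, v} \<in> E"
    show "\<exists>d\<in>darts Q. u = tail d \<and> (v = tail (opp Q d) \<or> v = tail (opp Q (nxt Q (opp Q d))))"
    proof (cases "{u, v} \<in> \<Union>X")
      case False
      then have "(Vert u, Vert v) \<in> darts Q" using uv by (intro dartI) (simp add: noncrossing_edges_def)
      then show ?thesis by (intro bexI[of _ "(Vert u, Vert v)"]) (simp_all add: opp_Q)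
    next
      case True
      then obtain c where c: "c \<in> X" "{u, v} \<in> c" by blast
      then have u: "u \<in> \<Union>c" by blast
      \<comment> \<open>\<open>x\<close> is next to \<open>u\<close> on the quadrangle around
        \<open>c\<close>, and \<open>w\<close> is the other neighbour of \<open>x\<close> there,
        hence opposite to \<open>u\<close>. Only one edge of \<open>c\<close> contains
        \<open>u\<close>, so \<open>w\<close> has to be \<open>v\<close>.\<close>
      obtain x where x: "x \<in> \<Union>c" "{u, x} \<in> noncrossing_edges E X" "\<rho> (Cross c) (Vert x) = Vert u"
        by (rule nxt_corner[OF c(1) u]) blast
      obtain u' w where w: "w \<in> \<Union>c" "\<rho> (Cross c) (Vert x) = Vert u'" "\<rho> (Cross c) (Vert w) = Vert x"
        "nxt Q (Vert x, Vert u') = (Vert x, Vert w)"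
        by (rule nxt_corner[OF c(1) x(1)]) blast
      have "{u, w} \<in> c" "u \<noteq> w" using diagonal[OF c(1) w(1,3) x(3)] by auto
      then have "{u, w} = {u, v}" using cross_disjoint[OF c(1) _ c(2), of "{u, w}" u] by blast
      then have "w = v" using \<open>u \<noteq> w\<close> by (auto simp: doubleton_eq_iff)
      moreover have "u' = u" using x(3) w(2) by simp
      ultimately show ?thesis
        using dartI[OF x(2)] w(4) by (intro bexI[of _ "(Vert u, Vert x)"]) (simp_all add: opp_Q)
    qed
  next
    assume "\<exists>d\<in>darts Q. u = tail d \<and> (v = tail (opp Q d) \<or> v = tail (opp Q (nxt Q (opp Q d))))"
    then obtain d where d: "d \<in> darts Q" "u = tail d" "v = tail (opp Q d) \<or> v = tail (opp Q (nxt Q (opp Q d)))"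
      by blast
    obtain x where x: "d = (Vert u, Vert x)" "{x, u} \<in> noncrossing_edges E X"
      by (rule dartE[OF d(1)]) (use d(2) in auto)
    then have ux: "{u, x} \<in> noncrossing_edges E X" by (simp add: insert_commute)
    obtain c w where w: "c \<in> X" "w \<in> \<Union>c" "\<rho> (Cross c) (Vert x) = Vert u" "\<rho> (Cross c) (Vert w) = Vert x"
      "nxt Q (Vert x, Vert u) = (Vert x, Vert w)"
      by (rule nxt_dart[OF ux]) blast
    have "v = x \<or> v = w" using d(3) x(1) w(5) by (simp add: opp_Q)
    moreover have "{u, x} \<in> E" using ux by (simp add: noncrossing_edges_def)
    moreover have "{u, w} \<in> E"
      using diagonal(1)[OF w(1,2,4,3)] cross_edge_in_E[OF w(1)] by blast
    ultimately show "{u, v} \<in> E" by blast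
  qed
qed (use graph conn reg in auto)

end

theorem theorem1:
  fixes V :: "'a set" and E :: "'a set set" and X :: "'a set set set"
    and \<rho> :: "'a point \<Rightarrow> 'a point \<Rightarrow> 'a point"
  assumes "optimal_one_toroidal V E X \<rho>"
    and "regular V E 8"
  shows "vertex_connectivity V E \<in> {6, 8} \<and>
    (k_connected V E 8 \<longleftrightarrow>
       \<not> (\<exists>p r. p \<ge> 4 \<and> r \<ge> 0 \<and>
            map_iso (quadrangular_subgraph E X \<rho>) (torus_quad p r 3)))"
proof -
  interpret optimal_drawing V E X \<rho>
    by (rule optimal_drawing.intro[OF assms])
  show ?thesis
    by (rule square_map.connectivity_torus_quad[OF square_map_Q refl refl refl])
qed

end
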